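(* For all $k\in\mathbb N$: $\mathrm{XC}_1\star\mathrm{AoUC}\not\le_{\mathrm W}\mathrm{XC}_k$.
   Context: A represented space $\mathbf X$ is a set $X$ with a partial surjection $\delta_{\mathbf X}:\subseteq\mathbb N^{\mathbb N}\to X$ (a $p$ with $\delta_{\mathbf X}(p)=x$ is a name of $x$). A realizer of a (partial) multivalued function $f:\subseteq\mathbf X\rightrightarrows\mathbf Y$ is a partial $F:\subseteq\mathbb N^{\mathbb N}\to\mathbb N^{\mathbb N}$ with $\delta_{\mathbf Y}(F(p))\in f(\delta_{\mathbf X}(p))$ for all names $p$ of points of $\mathrm{dom}(f)$; write $F\vdash f$. Weihrauch reducibility: $f\le_{\mathrm W}g$ iff there are computable $H,K:\subseteq\mathbb N^{\mathbb N}\to\mathbb N^{\mathbb N}$ such that $(p\mapsto K\langle p,GH(p)\rangle)\vdash f$ for every $G\vdash g$; $\equiv_{\mathrm W}$ is the induced equivalence. The compositional product $f\star g$ is (a representative of) the Weihrauch degree $\max_{\le_{\mathrm W}}\{f_1\circ g_1 : f_1\le_{\mathrm W}f,\ g_1\le_{\mathrm W}g\}$ (this maximum is known to exist), where the composition of multivalued functions has $\mathrm{dom}(f_1\circ g_1)=\{x\in\mathrm{dom}(g_1): g_1(x)\subseteq\mathrm{dom}(f_1)\}$ and $(f_1\circ g_1)(x)=\bigcup_{y\in g_1(x)}f_1(y)$. $\mathcal A(\mathbf X)$ is the represented space of closed subsets of $\mathbf X$ with negative information: a name of $A$ is a name of the open set $X\setminus A$ (its continuous characteristic function into Sierpiński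 space). Closed choice $\mathrm C_{\mathbf X}:\subseteq\mathcal A(\mathbf X)\rightrightarrows\mathbf X$ maps a non-empty closed set $A$ to an arbitrary point of $A$. $\mathrm{XC}_n$ is the restriction of $\mathrm C_{[0,1]^n}$ to (non-empty closed) convex sets. $\mathrm{AoUC}$ (all-or-unique choice) is the restriction of $\mathrm C_{\{0,1\}^{\mathbb N}}$ to the inputs $A$ with $A=\{0,1\}^{\mathbb N}$ or $A=\{x\}$ for some $x\in\{0,1\}^{\mathbb N}$ (up to $\equiv_{\mathrm W}$, $\{0,1\}^{\mathbb N}$ may be replaced by $[0,1]^d$, $d\ge1$). *)

theory Defs
  imports "HOL-Analysis.Analysis" "HOL-Library.Nat_Bijection" "HOL-Library.Countable"
begin

section \<open>Computable partial functions on Baire space\<close>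

type_synonym baire = "nat \<Rightarrow> nat"

text \<open>
  Partial recursive functions relative to a point of Baire space, uniformly in that point. Arguments are lists
  without a fixed arity; \<^const>\<open>None\<close> is divergence. In the last rule the search
  variable is the first argument, and all values below the zero that is found must be defined.
\<close>

inductive oracle_recursive :: "(baire \<Rightarrow> nat list \<Rightarrow> nat option) \<Rightarrow> bool" where
  zero: "oracle_recursive (\<lambda>p xs. Some 0)"
| succ: "oracle_recursive (\<lambda>p xs. case xs of [] \<Rightarrow> None | x # _ \<Rightarrow> Some (Suc x))"
| proj: "oracle_recursive (\<lambda>p xs. if i < length xs then Some (xs ! i) else None)"
| query: "oracle_recursive (\<lambda>p xs. case xs of [] \<Rightarrow> None | x # _ \<Rightarrow> Some (p x))"
| comp: "oracle_recursive f \<Longrightarrow> (\<And>g. g \<in> set gs \<Longrightarrow> oracle_recursive g) \<Longrightarrow>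
    oracle_recursive (\<lambda>p xs. Option.bind (those (map (\<lambda>g. g p xs) gs)) (f p))"
| prim_rec: "oracle_recursive f \<Longrightarrow> oracle_recursive g \<Longrightarrow>
    oracle_recursive (\<lambda>p xs. case xs of [] \<Rightarrow> None
      | n # ys \<Rightarrow> rec_nat (f p ys) (\<lambda>m r. Option.bind r (\<lambda>v. g p (m # v # ys))) n)"
| minimize: "oracle_recursive f \<Longrightarrow>
    oracle_recursive (\<lambda>p xs.
      if \<exists>n. f p (n # xs) = Some 0 \<and> (\<forall>m<n. \<exists>v. f p (m # xs) = Some (Suc v))
      then Some (LEAST n. f p (n # xs) = Some 0) else None)"

text \<open>As usual for partial functions on Baire space, restrictions of computable functions count as
  computable: nothing is required outside the domain of \<^term>\<open>F\<close>.\<close>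

definition computable :: "(baire \<Rightarrow> baire option) \<Rightarrow> bool" where
  "computable F \<longleftrightarrow> (\<exists>\<Phi>. oracle_recursive \<Phi> \<and>
     (\<forall>p q. F p = Some q \<longrightarrow> (\<forall>n. \<Phi> p [n] = Some (q n))))"

definition baire_pair :: "baire \<Rightarrow> baire \<Rightarrow> baire" where
  "baire_pair p q n = (if even n then p (n div 2) else q (n div 2))"


section \<open>Represented spaces and multivalued functions\<close>

text \<open>A representation determines its underlying set, namely its range. Thus a represented space
  is just a partial function from Baire space.\<close>

type_synonym 'a repr = "baire \<Rightarrow> 'a option"

definition points :: "'a repr \<Rightarrow> 'a set" where
  "points \<delta> = {x. \<exists>p. \<delta> p = Some x}"

definition repr_of :: "(baire \<Rightarrow> 'a \<Rightarrow> bool) \<Rightarrow> 'a repr" where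
  "repr_of R p = (if \<exists>!x. R p x then Some (THE x. R p x) else None)"

lemma repr_of_eq_Some_iff:
  assumes "\<And>x y. R p x \<Longrightarrow> R p y \<Longrightarrow> x = y"
  shows "repr_of R p = Some x \<longleftrightarrow> R p x"
  using assms by (auto simp: repr_of_def intro: theI2)

text \<open>Partial multivalued functions between represented spaces; the domain consists of the points
  with non-empty image.\<close>

record ('a, 'b) problem =
  src :: "'a repr"
  tgt :: "'b repr"
  mv :: "'a \<Rightarrow> 'b set"

definition mdom :: "('a, 'b) problem \<Rightarrow> 'a set" where
  "mdom f = {x. mv f x \<noteq> {}}"

definition valid_problem :: "('a, 'b) problem \<Rightarrow> bool" where
  "valid_problem f \<longleftrightarrow> mdom f \<subseteq> points (src f) \<and> (\<forall>x. mv f x \<subseteq> points (tgt f))"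

definition restrict_problem :: "('a, 'b) problem \<Rightarrow> ('a \<Rightarrow> bool) \<Rightarrow> ('a, 'b) problem" where
  "restrict_problem f P = f\<lparr>mv := \<lambda>x. if P x then mv f x else {}\<rparr>"

text \<open>To be used only if \<^term>\<open>tgt g = src f\<close>.\<close>

definition mcomp :: "('b, 'c) problem \<Rightarrow> ('a, 'b) problem \<Rightarrow> ('a, 'c) problem" where
  "mcomp f g = \<lparr>src = src g, tgt = tgt f,
     mv = \<lambda>x. if x \<in> mdom g \<and> mv g x \<subseteq> mdom f then \<Union>y\<in>mv g x. mv f y else {}\<rparr>"

definition realizes :: "(baire \<Rightarrow> baire option) \<Rightarrow> ('a, 'b) problem \<Rightarrow> bool" where
  "realizes F f \<longleftrightarrow> (\<forall>p x. src f p = Some x \<and> x \<in> mdom f \<longrightarrow>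
     (\<exists>q y. F p = Some q \<and> tgt f q = Some y \<and> y \<in> mv f x))"


section \<open>Weihrauch reducibility\<close>

definition weihrauch_le :: "('a, 'b) problem \<Rightarrow> ('c, 'd) problem \<Rightarrow> bool"
    (infix \<open>\<le>\<^sub>W\<close> 50) where
  "f \<le>\<^sub>W g \<longleftrightarrow> (\<exists>H K. computable H \<and> computable K \<and>
     (\<forall>G. realizes G g \<longrightarrow>
       realizes (\<lambda>p. Option.bind (H p) (\<lambda>h. Option.bind (G h) (\<lambda>q. K (baire_pair p q)))) f))"

definition weihrauch_eq :: "('a, 'b) problem \<Rightarrow> ('c, 'd) problem \<Rightarrow> bool"
    (infix \<open>\<equiv>\<^sub>W\<close> 50) where
  "f \<equiv>\<^sub>W g \<longleftrightarrow> f \<le>\<^sub>W g \<and> g \<le>\<^sub>W f"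

text \<open>
  The compositions whose maximal Weihrauch degree is the compositional product. The represented
  spaces range over all those with points in \<^typ>\<open>baire\<close>; this is no restriction, since
  every represented space has at most as many points as there are names, so it is isomorphic, by a
  renaming of points that keeps all names, to one of these.
\<close>

definition comp_candidate ::
    "('a, 'b) problem \<Rightarrow> ('c, 'd) problem \<Rightarrow> (baire, baire) problem \<Rightarrow> bool" where
  "comp_candidate f g h \<longleftrightarrow> (\<exists>(f1 :: (baire, baire) problem) (g1 :: (baire, baire) problem).
     valid_problem f1 \<and> valid_problem g1 \<and> tgt g1 = src f1 \<and>
     f1 \<le>\<^sub>W f \<and> g1 \<le>\<^sub>W g \<and> h = mcomp f1 g1)"

text \<open>\<^term>\<open>h\<close> is a representative of the compositional product of \<^term>\<open>f\<close> and
  \<^term>\<open>g\<close>, where \<^term>\<open>g\<close> is applied first.\<close>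

definition is_comp_product ::
    "('a, 'b) problem \<Rightarrow> ('c, 'd) problem \<Rightarrow> ('e, 'f) problem \<Rightarrow> bool" where
  "is_comp_product f g h \<longleftrightarrow> valid_problem h \<and>
     (\<exists>h0. comp_candidate f g h0 \<and> h \<equiv>\<^sub>W h0) \<and>
     (\<forall>h1. comp_candidate f g h1 \<longrightarrow> h1 \<le>\<^sub>W h)"


section \<open>Closed sets with negative information\<close>

text \<open>
  The partial continuous function with associate \<^term>\<open>p\<close>: on input \<^term>\<open>q\<close> and
  \<^term>\<open>n\<close>, a positive value of \<^term>\<open>p\<close> at a code of \<^term>\<open>n\<close> followed by a
  prefix of \<^term>\<open>q\<close> is one more than the output; the shortest such prefix counts.
\<close>

definition assoc_query :: "baire \<Rightarrow> nat \<Rightarrow> nat \<Rightarrow> nat" where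
  "assoc_query q n m = list_encode (n # map q [0..<m])"

definition assoc_fun :: "baire \<Rightarrow> baire \<Rightarrow> baire option" where
  "assoc_fun p q =
     (if \<forall>n. \<exists>m. p (assoc_query q n m) \<noteq> 0
      then Some (\<lambda>n. p (assoc_query q n (LEAST m. p (assoc_query q n m) \<noteq> 0)) - 1)
      else None)"

text \<open>A name of a function is an associate of a realizer.\<close>

definition function_name :: "'a repr \<Rightarrow> 'b repr \<Rightarrow> baire \<Rightarrow> ('a \<Rightarrow> 'b) \<Rightarrow> bool" where
  "function_name \<delta> \<epsilon> p f \<longleftrightarrow>
     (\<forall>q x. \<delta> q = Some x \<longrightarrow> (\<exists>r. assoc_fun p q = Some r \<and> \<epsilon> r = Some (f x)))"

definition sierpinski :: "bool repr" where
  "sierpinski p = Some (\<exists>n. p n \<noteq> 0)"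

definition closed_name :: "'a repr \<Rightarrow> baire \<Rightarrow> 'a set \<Rightarrow> bool" where
  "closed_name \<delta> p A \<longleftrightarrow> A \<subseteq> points \<delta> \<and> function_name \<delta> sierpinski p (\<lambda>x. x \<notin> A)"

definition closed_sets :: "'a repr \<Rightarrow> 'a set repr" where
  "closed_sets \<delta> = repr_of (closed_name \<delta>)"

lemma closed_name_unique:
  assumes "closed_name \<delta> p A" "closed_name \<delta> p B"
  shows "A = B"
proof -
  have "x \<in> A \<longleftrightarrow> x \<in> B" if x: "x \<in> points \<delta>" for x
  proof -
    obtain q where "\<delta> q = Some x" using x by (auto simp: points_def)
    then obtain r s where "assoc_fun p q = Some r" "sierpinski r = Some (x \<notin> A)"
        "assoc_fun p q = Some s" "sierpinski s = Some (x \<notin> B)"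
      using assms unfolding closed_name_def function_name_def by meson
    then show ?thesis by simp
  qed
  then show ?thesis using assms unfolding closed_name_def by blast
qed

lemma closed_sets_eq_Some_iff: "closed_sets \<delta> p = Some A \<longleftrightarrow> closed_name \<delta> p A"
  unfolding closed_sets_def by (rule repr_of_eq_Some_iff) (rule closed_name_unique)

definition closed_choice :: "'a repr \<Rightarrow> ('a set, 'a) problem" where
  "closed_choice \<delta> = \<lparr>src = closed_sets \<delta>, tgt = \<delta>,
     mv = \<lambda>A. if A \<in> points (closed_sets \<delta>) then A else {}\<rparr>"

lemma valid_problem_closed_choice: "valid_problem (closed_choice \<delta>)"
  by (auto simp: valid_problem_def closed_choice_def mdom_def points_def closed_sets_eq_Some_iff
      closed_name_def split: if_splits)

lemma valid_problem_restrict: "valid_problem f \<Longrightarrow> valid_problem (restrict_problem f P)"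
  by (auto simp: valid_problem_def restrict_problem_def mdom_def split: if_splits)


section \<open>Convex choice and all-or-unique choice\<close>

definition cube :: "nat \<Rightarrow> (nat \<Rightarrow> real) set" where
  "cube n = {..<n} \<rightarrow>\<^sub>E {0..1}"

text \<open>Names consist of one fast Cauchy sequence of rationals for each coordinate.\<close>

definition cube_name :: "nat \<Rightarrow> baire \<Rightarrow> (nat \<Rightarrow> real) \<Rightarrow> bool" where
  "cube_name n p x \<longleftrightarrow> x \<in> cube n \<and>
     (\<forall>i<n. \<forall>m. \<bar>real_of_rat (nat_to_rat_surj (p (prod_encode (i, m)))) - x i\<bar> \<le> 1 / 2 ^ m)"

definition cube_repr :: "nat \<Rightarrow> (nat \<Rightarrow> real) repr" where
  "cube_repr n = repr_of (cube_name n)"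

lemma cube_name_unique:
  assumes "cube_name n p x" "cube_name n p y"
  shows "x = y"
proof (rule PiE_ext)
  show "x \<in> {..<n} \<rightarrow>\<^sub>E {0..1}" "y \<in> {..<n} \<rightarrow>\<^sub>E {0..1}"
    using assms by (auto simp: cube_name_def cube_def)
  fix i assume i: "i \<in> {..<n}"
  have le: "\<bar>x i - y i\<bar> \<le> 2 * (1 / 2) ^ m" for m
  proof -
    let ?r = "real_of_rat (nat_to_rat_surj (p (prod_encode (i, m))))"
    have "\<bar>?r - x i\<bar> \<le> (1 / 2) ^ m" "\<bar>?r - y i\<bar> \<le> (1 / 2) ^ m"
      using assms i by (auto simp: cube_name_def power_one_over)
    then show ?thesis by linarith
  qed
  have "(\<lambda>m. 2 * (1 / 2) ^ m :: real) \<longlonglongrightarrow> 2 * 0"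
    by (intro tendsto_intros LIMSEQ_realpow_zero) auto
  then have "\<bar>x i - y i\<bar> \<le> 2 * 0"
    by (rule LIMSEQ_le_const) (use le in auto)
  then show "x i = y i" by simp
qed

lemma cube_repr_eq_Some_iff: "cube_repr n p = Some x \<longleftrightarrow> cube_name n p x"
  unfolding cube_repr_def by (rule repr_of_eq_Some_iff) (rule cube_name_unique)

lemma points_cube_repr: "points (cube_repr n) = cube n"
proof
  show "points (cube_repr n) \<subseteq> cube n"
    by (auto simp: points_def cube_repr_eq_Some_iff cube_name_def)
  show "cube n \<subseteq> points (cube_repr n)"
  proof
    fix x assume x: "x \<in> cube n"
    have "\<exists>k. \<bar>real_of_rat (nat_to_rat_surj k) - x i\<bar> \<le> 1 / 2 ^ m" for i and m :: nat
    proof -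
      obtain q where q: "x i < of_rat q" "of_rat q < x i + 1 / 2 ^ m"
        using of_rat_dense[of "x i" "x i + 1 / 2 ^ m"] by auto
      obtain k where "q = nat_to_rat_surj k" using surj_nat_to_rat_surj by blast
      then show ?thesis using q by (intro exI[of _ k]) auto
    qed
    then obtain k where
      "\<And>i m. \<bar>real_of_rat (nat_to_rat_surj (k i m)) - x i\<bar> \<le> 1 / 2 ^ (m :: nat)"
      by metis
    then have "cube_name n (\<lambda>j. case prod_decode j of (i, m) \<Rightarrow> k i m) x"
      using x by (simp add: cube_name_def)
    then show "x \<in> points (cube_repr n)" by (auto simp: points_def cube_repr_eq_Some_iff)
  qed
qed

text \<open>Functions carry no vector space structure in the library, so convexity is spelled out.\<close>

definition cube_convex :: "nat \<Rightarrow> (nat \<Rightarrow> real) set \<Rightarrow> bool" where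
  "cube_convex n A \<longleftrightarrow>
     (\<forall>x\<in>A. \<forall>y\<in>A. \<forall>t\<in>{0..1}. (\<lambda>i\<in>{..<n}. (1 - t) * x i + t * y i) \<in> A)"

definition XC :: "nat \<Rightarrow> ((nat \<Rightarrow> real) set, nat \<Rightarrow> real) problem" where
  "XC n = restrict_problem (closed_choice (cube_repr n)) (cube_convex n)"

definition cantor :: "baire set" where
  "cantor = {p. \<forall>n. p n \<in> {0, 1}}"

definition cantor_repr :: "baire repr" where
  "cantor_repr p = (if p \<in> cantor then Some p else None)"

definition AoUC :: "(baire set, baire) problem" where
  "AoUC = restrict_problem (closed_choice cantor_repr)
     (\<lambda>A. A = cantor \<or> (\<exists>x\<in>cantor. A = {x}))"

end

theory Submission
  imports Defs "HOL-Library.Function_Algebras"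
begin

text \<open>
  Only the continuity of computable functionals matters. Consider the composition that asks for a
  point \<open>q\<close> of a set \<open>A\<close>, all of Cantor space or a singleton, and for a point of a closed interval
  \<open>B\<^sub>i\<close>, where \<open>i\<close> is the number of ones among the first \<open>k\<close> digits of \<open>q\<close>. A reduction to convex
  choice turns an instance \<open>p\<close> into a convex set \<open>C p\<close>. Start with the instance \<open>p\<^sub>0\<close> that removes
  nothing, and for \<open>i = 0, \<dots>, k\<close> restrict \<open>B\<^sub>i\<close> to a point \<open>b\<^sub>i\<close>, each time later and later, passing to
  the limit of the solution sets. The limits form a decreasing sequence of non-empty convex subsets
  of \<open>C p\<^sub>0\<close>. Since \<open>A\<close> may still be restricted to a point with \<open>i\<close> ones, each limit contains points
  with a name that the reduction, on \<open>p\<^sub>0\<close>, maps to a \<open>q\<close> with \<open>i\<close> ones. These points form a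
  relatively open set, on which the limits for different values of \<open>b\<^sub>i\<close> are disjoint. There are
  uncountably many such values, so for one of them the limit has smaller dimension than the
  previous set. This cannot happen \<open>k + 1\<close> times in a cube of dimension \<open>k\<close>.
\<close>

section \<open>Pointwise convergence in function spaces and in Baire space\<close>

lemma tendsto_fun_iff:
  fixes f :: "'c \<Rightarrow> 'a \<Rightarrow> 'b :: topological_space"
  shows "(f \<longlongrightarrow> l) F \<longleftrightarrow> (\<forall>i. ((\<lambda>x. f x i) \<longlongrightarrow> l i) F)"
  using limitin_componentwise[of "\<lambda>_. euclidean" UNIV f l F]
  by (simp add: euclidean_product_topology)

lemma tendsto_nat_iff:
  fixes f :: "'c \<Rightarrow> nat"
  shows "(f \<longlongrightarrow> l) F \<longleftrightarrow> eventually (\<lambda>x. f x = l) F"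
  by (simp add: tendsto_discrete)

lemma tendsto_baire_iff:
  fixes f :: "'c \<Rightarrow> baire"
  shows "(f \<longlongrightarrow> l) F \<longleftrightarrow> (\<forall>i. eventually (\<lambda>x. f x i = l i) F)"
  by (simp add: tendsto_fun_iff tendsto_nat_iff)

lemma eventually_nhds_baire: "eventually (\<lambda>q. q i = p i) (nhds p)" for p :: baire
  using filterlim_ident[of "nhds p"] by (simp add: tendsto_baire_iff)

lemma those_Some_iff: "those xs = Some ys \<longleftrightarrow> xs = map Some ys"
proof (induction xs arbitrary: ys)
  case (Cons a xs)
  then show ?case by (cases a; cases ys) auto
qed auto

section \<open>Computable functionals are continuous\<close>

text \<open>A halting computation reads only finitely many values of the oracle. In the induction
  each rule combines finitely many subcomputations, so finitely many neighbourhoods are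
  intersected.\<close>

lemma oracle_recursive_eventually:
  assumes "oracle_recursive \<Phi>" "\<Phi> p xs = Some v"
  shows "eventually (\<lambda>q. \<Phi> q xs = Some v) (nhds p)"
  using assms
proof (induction arbitrary: xs v)
  case query
  then obtain x ys where "xs = x # ys" "v = p x" by (cases xs) auto
  then show ?case using eventually_nhds_baire[of x p] by simp
next
  case (comp f gs)
  then obtain ys where ys: "those (map (\<lambda>g. g p xs) gs) = Some ys" "f p ys = Some v"
    by (auto simp: bind_eq_Some_conv)
  have len: "length ys = length gs" using ys(1) by (metis those_Some_iff length_map)
  have "eventually (\<lambda>q. \<forall>i\<in>{..<length gs}. (gs ! i) q xs = Some (ys ! i)) (nhds p)"
  proof (rule eventually_ball_finite, simp, rule ballI)
    fix i assume i: "i \<in> {..<length gs}"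
    have "map (\<lambda>g. g p xs) gs ! i = map Some ys ! i"
      using ys(1) by (simp add: those_Some_iff)
    then have "(gs ! i) p xs = Some (ys ! i)" using i len by simp
    then show "eventually (\<lambda>q. (gs ! i) q xs = Some (ys ! i)) (nhds p)"
      using comp.IH(2)[of "gs ! i"] i by simp
  qed
  moreover have "eventually (\<lambda>q. f q ys = Some v) (nhds p)" using comp.IH(1) ys(2) .
  ultimately show ?case
  proof eventually_elim
    case (elim q)
    have "map (\<lambda>g. g q xs) gs = map Some ys"
      using elim(1) len by (intro nth_equalityI) auto
    then show ?case using elim(2) by (simp add: those_Some_iff[THEN iffD2])
  qed
next
  case (prim_rec f g)
  then obtain n ys where xs: "xs = n # ys" by (cases xs) auto
  let ?r = "\<lambda>q. rec_nat (f q ys) (\<lambda>m r. Option.bind r (\<lambda>v. g q (m # v # ys)))"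
  have "?r p n = Some v \<Longrightarrow> eventually (\<lambda>q. ?r q n = Some v) (nhds p)" for n v
  proof (induction n arbitrary: v)
    case 0
    then show ?case using prim_rec.IH(1) by simp
  next
    case (Suc n)
    then obtain u where u: "?r p n = Some u" "g p (n # u # ys) = Some v"
      by (auto simp: bind_eq_Some_conv)
    show ?case using Suc.IH[OF u(1)] prim_rec.IH(2)[OF u(2)] by eventually_elim simp
  qed
  then show ?case using prim_rec.prems xs by simp
next
  case (minimize f)
  then obtain n where n: "f p (n # xs) = Some 0" "\<forall>m<n. \<exists>v. f p (m # xs) = Some (Suc v)"
    by (auto split: if_splits)
  then obtain w where w: "\<And>m. m < n \<Longrightarrow> f p (m # xs) = Some (Suc (w m))" by metis
  \<comment> \<open>The positive values below \<open>n\<close> exclude an earlier zero, so the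
    search stops at \<open>n\<close> for every oracle that reproduces these values.\<close>
  have least: "(LEAST n. f q (n # xs) = Some 0) = n"
    if "f q (n # xs) = Some 0" "\<forall>m\<in>{..<n}. f q (m # xs) = Some (Suc (w m))" for q
    using that by (intro Least_equality) (auto simp: not_less[symmetric])
  have v: "v = n" using minimize.prems least[of p] n w by (auto split: if_splits)
  have "eventually (\<lambda>q. \<forall>m\<in>{..<n}. f q (m # xs) = Some (Suc (w m))) (nhds p)"
    using minimize.IH w by (intro eventually_ball_finite) auto
  with minimize.IH[OF n(1)] show ?case
  proof eventually_elim
    case (elim q)
    then have "\<exists>n. f q (n # xs) = Some 0 \<and> (\<forall>m<n. \<exists>v. f q (m # xs) = Some (Suc v))" by auto
    then show ?case using least[of q] elim v by simp
  qed
qed (auto split: list.splits if_splits)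

text \<open>Each digit of the output is fixed by a neighbourhood of the input. Since
  \<open>F\<close> is partial, its values along the sequence and at the limit are given as
  hypotheses.\<close>

lemma computable_tendsto:
  assumes F: "computable F" and P: "P \<longlonglongrightarrow> p" and "F p = Some q" "\<And>j. F (P j) = Some (Q j)"
  shows "Q \<longlonglongrightarrow> q"
proof -
  obtain \<Phi> where \<Phi>: "oracle_recursive \<Phi>" "\<And>p q n. F p = Some q \<Longrightarrow> \<Phi> p [n] = Some (q n)"
    using F by (auto simp: computable_def)
  have "eventually (\<lambda>j. \<Phi> (P j) [n] = Some (q n)) sequentially" for n
    using filterlim_iff[THEN iffD1, OF P] oracle_recursive_eventually[OF \<Phi>(1)] \<Phi>(2) assms(3)
    by blast
  then show ?thesis using \<Phi>(2) assms(4) by (simp add: tendsto_baire_iff)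
qed

lemma baire_pair_tendsto:
  assumes "P \<longlonglongrightarrow> p" "Q \<longlonglongrightarrow> q"
  shows "(\<lambda>j. baire_pair (P j) (Q j)) \<longlonglongrightarrow> baire_pair p q"
  using assms by (auto simp: tendsto_baire_iff baire_pair_def)

lemma baire_pair_even_odd [simp]:
  "baire_pair p q (2 * n) = p n" "baire_pair p q (Suc (2 * n)) = q n"
  by (auto simp: baire_pair_def)

section \<open>Some computable functionals\<close>

definition computable_op :: "(baire \<Rightarrow> baire) \<Rightarrow> bool" where
  "computable_op f \<longleftrightarrow> (\<exists>\<Phi>. oracle_recursive \<Phi> \<and> (\<forall>p n. \<Phi> p [n] = Some (f p n)))"

lemma computable_opI:
  "oracle_recursive \<Phi> \<Longrightarrow> (\<And>p n. \<Phi> p [n] = Some (f p n)) \<Longrightarrow> computable_op f"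
  unfolding computable_op_def by blast

lemma computable_op_computable: "computable_op f \<Longrightarrow> computable (\<lambda>p. Some (f p))"
  unfolding computable_op_def computable_def by auto

lemma computable_op_query: "computable_op (\<lambda>p. p)"
  by (rule computable_opI[OF oracle_recursive.query]) simp

lemma computable_op_Suc: "computable_op (\<lambda>p. Suc)"
  by (rule computable_opI[OF oracle_recursive.succ]) simp

lemma computable_op_comp:
  assumes "computable_op f" "computable_op g"
  shows "computable_op (\<lambda>p n. f p (g p n))"
proof -
  obtain \<Phi> \<Psi> where *: "oracle_recursive \<Phi>" "\<And>p n. \<Phi> p [n] = Some (f p n)"
    "oracle_recursive \<Psi>" "\<And>p n. \<Psi> p [n] = Some (g p n)"
    using assms unfolding computable_op_def by auto
  have "oracle_recursive (\<lambda>p xs. Option.bind (those (map (\<lambda>h. h p xs) [\<Psi>])) (\<Phi> p))"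
    by (rule oracle_recursive.comp[OF *(1)]) (simp add: *)
  then show ?thesis by (rule computable_opI) (simp add: *)
qed

lemma computable_op_const: "computable_op (\<lambda>p n. c)"
proof (induction c)
  case 0
  show ?case by (rule computable_opI[OF oracle_recursive.zero]) simp
next
  case (Suc c)
  show ?case using computable_op_comp[OF computable_op_Suc Suc] .
qed

text \<open>In primitive recursion the step function receives the counter first and the previous
  value second; this turns a unary functional into a step that ignores the counter.\<close>

lemma oracle_recursive_second:
  assumes "oracle_recursive \<Phi>"
  shows "oracle_recursive (\<lambda>p xs. if Suc 0 < length xs then \<Phi> p [xs ! Suc 0] else None)"
proof -
  have "oracle_recursive (\<lambda>p xs. Option.bind (those (map (\<lambda>h. h p xs)
      [\<lambda>p xs. if Suc 0 < length xs then Some (xs ! Suc 0) else None])) (\<Phi> p))"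
    by (rule oracle_recursive.comp[OF assms]) (auto intro: oracle_recursive.proj)
  moreover have "(\<lambda>p xs. Option.bind (those (map (\<lambda>h. h p xs)
      [\<lambda>p xs. if Suc 0 < length xs then Some (xs ! Suc 0) else None])) (\<Phi> p))
    = (\<lambda>p xs. if Suc 0 < length xs then \<Phi> p [xs ! Suc 0] else None)"
    by (intro ext) simp
  ultimately show ?thesis by metis
qed

lemma computable_op_double: "computable_op (\<lambda>p n. 2 * n)"
proof -
  obtain \<Phi> where \<Phi>: "oracle_recursive \<Phi>" "\<And>p n. \<Phi> p [n] = Some (Suc (Suc n))"
    using computable_op_comp[OF computable_op_Suc computable_op_Suc]
    unfolding computable_op_def by auto
  have "rec_nat (Some 0) (\<lambda>m r. Option.bind r (\<lambda>v. Some (Suc (Suc v)))) n = Some (2 * n)" for n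
    by (induction n) auto
  then show ?thesis
    using computable_opI[OF oracle_recursive.prim_rec[OF oracle_recursive.zero
      oracle_recursive_second[OF \<Phi>(1)]], of "\<lambda>p n. 2 * n"]
    by (simp add: \<Phi>)
qed

text \<open>Positions in slices are odd numbers times powers of two, so iterated doubling takes the
  place of general multiplication and exponentiation.\<close>

lemma computable_op_double_iter:
  assumes "computable_op f" "computable_op g"
  shows "computable_op (\<lambda>p n. 2 ^ f p n * g p n)"
proof -
  obtain \<Phi> \<Psi> \<Delta> where *: "oracle_recursive \<Phi>" "\<And>p n. \<Phi> p [n] = Some (f p n)"
    "oracle_recursive \<Psi>" "\<And>p n. \<Psi> p [n] = Some (g p n)"
    "oracle_recursive \<Delta>" "\<And>p n. \<Delta> p [n] = Some (2 * n)"
    using assms computable_op_double unfolding computable_op_def by metis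
  obtain R where R: "oracle_recursive R" "\<And>p m n. R p [m, n] =
      rec_nat (Some n) (\<lambda>m r. Option.bind r (\<lambda>v. \<Delta> p [v])) m"
    using oracle_recursive.prim_rec[OF oracle_recursive.proj[of 0] oracle_recursive_second[OF *(5)]]
    by (rule that) simp
  have "rec_nat (Some n) (\<lambda>m r. Option.bind r (\<lambda>v. \<Delta> p [v])) m = Some (2 ^ m * n)" for p n m
    by (induction m) (simp_all add: *)
  then have R': "R p [m, n] = Some (2 ^ m * n)" for p m n by (simp add: R(2))
  have "oracle_recursive (\<lambda>p xs. Option.bind (those (map (\<lambda>h. h p xs) [\<Phi>, \<Psi>])) (R p))"
    by (rule oracle_recursive.comp[OF R(1)]) (auto simp: *)
  then show ?thesis by (rule computable_opI) (simp add: * R')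
qed

section \<open>A composition of convex choice with all-or-unique choice\<close>

text \<open>Every positive number is \<open>2 ^ i * (2 * n + 1)\<close> for exactly one pair, so the
  slices are disjoint and miss only position 0. Slice 0 will name the set A, slice
  \<open>Suc i\<close> the set B_i.\<close>

definition slice :: "baire \<Rightarrow> nat \<Rightarrow> baire" where
  "slice p i n = p (2 ^ i * (2 * n + 1))"

text \<open>The recursion follows the number of factors 2 in the position: odd positions form slice
  0, and halving the even ones lowers the index of the slice by one.\<close>

primrec put_slice :: "nat \<Rightarrow> baire \<Rightarrow> baire \<Rightarrow> baire" where
  "put_slice 0 a p = (\<lambda>n. if odd n then a (n div 2) else p n)"
| "put_slice (Suc i) a p =
    (\<lambda>n. if odd n then p n else put_slice i a (\<lambda>n. p (2 * n)) (n div 2))"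

lemma slice_0: "slice p 0 n = p (Suc (2 * n))"
  by (simp add: slice_def)

lemma slice_Suc: "slice p (Suc i) n = slice (\<lambda>n. p (2 * n)) i n"
  by (simp add: slice_def ac_simps)

lemma slice_put_slice: "slice (put_slice i a p) i' = (if i' = i then a else slice p i')"
proof (rule ext)
  fix n show "slice (put_slice i a p) i' n = (if i' = i then a else slice p i') n"
  proof (induction i arbitrary: p i')
    case 0
    show ?case by (cases i') (simp_all add: slice_def)
  next
    case (Suc i)
    then show ?case by (cases i') (simp_all add: slice_0 slice_Suc)
  qed
qed

text \<open>An entry of a slice never has a larger index than its position in the whole sequence, so
  agreement up to index \<open>n\<close> settles position \<open>n\<close>.\<close>

lemma put_slice_agree:
  assumes "\<And>j. j \<le> n \<Longrightarrow> slice p i j = a j"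
  shows "put_slice i a p n = p n"
  using assms
proof (induction i arbitrary: p n)
  case 0
  then show ?case using "0.prems"[of "n div 2"] by (auto simp: slice_0 elim: oddE)
next
  case (Suc i)
  have "put_slice i a (\<lambda>n. p (2 * n)) (n div 2) = p (2 * (n div 2))" if "even n"
    by (rule Suc.IH) (use Suc.prems in \<open>auto simp: slice_Suc\<close>)
  then show ?case by auto
qed

declare put_slice.simps [simp del]

text \<open>The input is kept in the output, so that the outer problem in a composition sees it too.\<close>

definition lift_problem ::
    "('a, 'b) problem \<Rightarrow> (baire \<Rightarrow> baire) \<Rightarrow> (baire, baire) problem" where
  "lift_problem P H = \<lparr>src = Some, tgt = Some,
     mv = \<lambda>x. {baire_pair x s | s y A. src P (H x) = Some A \<and> y \<in> mv P A \<and> tgt P s = Some y}\<rparr>"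

lemma valid_lift_problem: "valid_problem (lift_problem P H)"
  by (auto simp: valid_problem_def lift_problem_def points_def)

text \<open>The outer functional is the identity: the input paired with a solution is already a
  solution of the lifted problem.\<close>

lemma lift_problem_le:
  assumes "computable_op H"
  shows "lift_problem P H \<le>\<^sub>W P"
proof -
  have "realizes (\<lambda>p. Option.bind (Some (H p)) (\<lambda>h. Option.bind (G h) (\<lambda>q. Some (baire_pair p q))))
      (lift_problem P H)" if G: "realizes G P" for G
    unfolding realizes_def
  proof (intro allI impI, elim conjE)
    fix p x assume "src (lift_problem P H) p = Some x" "x \<in> mdom (lift_problem P H)"
    then obtain y A where "x = p" "src P (H p) = Some A" "y \<in> mv P A"
      by (auto simp: lift_problem_def mdom_def)
    moreover from this obtain s y' where "G (H p) = Some s" "tgt P s = Some y'" "y' \<in> mv P A"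
      using G unfolding realizes_def mdom_def by blast
    ultimately show "\<exists>q y. Option.bind (Some (H p)) (\<lambda>h. Option.bind (G h)
        (\<lambda>q. Some (baire_pair p q))) = Some q \<and> tgt (lift_problem P H) q = Some y
        \<and> y \<in> mv (lift_problem P H) x"
      by (auto simp: lift_problem_def)
  qed
  then show ?thesis unfolding weihrauch_le_def
    using computable_op_computable[OF assms] computable_op_computable[OF computable_op_query]
    by blast
qed

definition ones :: "nat \<Rightarrow> baire \<Rightarrow> nat" where
  "ones k q = (\<Sum>j<k. q j)"

text \<open>The input is a pair of an instance and a point \<open>q\<close> of its set A; the result
  is the name of B_i for i = \<open>ones k q\<close>. The successor skips slice 0, which holds
  A.\<close>

definition selected_slice :: "nat \<Rightarrow> baire \<Rightarrow> baire" where
  "selected_slice k x = slice (\<lambda>n. x (2 * n)) (Suc (ones k (\<lambda>n. x (Suc (2 * n)))))"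

lemma computable_slice_0: "computable_op (\<lambda>p. slice p 0)"
  using computable_op_comp[OF computable_op_query computable_op_comp[OF computable_op_Suc
    computable_op_double]] by (simp add: slice_def[abs_def])

lemma computable_selected_slice: "computable_op (selected_slice k)"
proof -
  \<comment> \<open>One factor 2 leads to the even half of the pair, the other comes from the
    successor in the index of the slice.\<close>
  have 1: "computable_op (\<lambda>p n. 2 * (2 * Suc (2 * n)))"
    by (intro computable_op_comp[OF computable_op_double] computable_op_comp[OF computable_op_Suc]
      computable_op_double)
  have "computable_op (\<lambda>x n. 2 ^ ones k (\<lambda>n. x (Suc (2 * n))) * (2 * (2 * Suc (2 * n))))"
  \<comment> \<open>The exponent is a sum of digits at fixed positions, so each digit contributes
    its own iterated doubling.\<close>
  proof (induction k)
    case 0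
    show ?case using 1 by (simp add: ones_def)
  next
    case (Suc k)
    have *: "computable_op (\<lambda>x n. x (Suc (2 * k)))"
      using computable_op_comp[OF computable_op_query computable_op_const] .
    have "2 ^ ones (Suc k) f * c = 2 ^ f k * (2 ^ ones k f * c)" for f and c :: nat
      by (simp add: ones_def power_add ac_simps)
    then show ?case using computable_op_double_iter[OF * Suc] by (simp only:)
  qed
  from computable_op_comp[OF computable_op_query this] show ?thesis
    by (simp add: selected_slice_def[abs_def] slice_def[abs_def] mult.left_commute mult.assoc)
qed

definition composition :: "nat \<Rightarrow> (baire, baire) problem" where
  "composition k =
     mcomp (lift_problem (XC 1) (selected_slice k)) (lift_problem AoUC (\<lambda>p. slice p 0))"

lemma comp_candidate_composition: "comp_candidate (XC 1) AoUC (composition k)"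
  unfolding comp_candidate_def composition_def
  by (intro exI[of _ "lift_problem (XC 1) (selected_slice k)"]
      exI[of _ "lift_problem AoUC (\<lambda>p. slice p 0)"] conjI valid_lift_problem lift_problem_le
      computable_slice_0 computable_selected_slice refl)
    (simp add: lift_problem_def)

section \<open>Names of singletons that are revealed late\<close>

text \<open>As values of an associate, 0 means undecided, 1 no evidence and 2 removal. Output
  \<open>n\<close> waits for \<open>n\<close> digits and then removes the point if no name of
  \<open>x\<close> starts with them. Below \<open>t\<close> the sequence agrees with the constant 1,
  which names the whole space.\<close>

definition late_name :: "'a repr \<Rightarrow> 'a \<Rightarrow> nat \<Rightarrow> baire" where
  "late_name \<delta> x t code = (if code < t then 1 else case list_decode code of [] \<Rightarrow> 1
     | n # l \<Rightarrow> if length l < n then 0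
         else if \<exists>q. \<delta> q = Some x \<and> map q [0..<length l] = l then 1 else 2)"

lemma late_name_agree: "j < t \<Longrightarrow> late_name \<delta> x t j = 1"
  by (simp add: late_name_def)

text \<open>The value 1 encodes output 0 after the empty prefix, so no point is ever
  removed.\<close>

lemma closed_name_all: "closed_name \<delta> (\<lambda>_. 1) (points \<delta>)"
  by (auto simp: closed_name_def function_name_def assoc_fun_def sierpinski_def points_def)

lemma le_list_encode_Cons: "n \<le> list_encode (n # l)"
  using le_prod_encode_1[of n "list_encode l"] by simp

text \<open>A name of \<open>x\<close> is never refuted, because each of its prefixes begins a name
  of \<open>x\<close>. Any other point is refuted once the prefix is long enough for
  \<open>sep\<close>.\<close>

lemma closed_name_late_name:
  assumes x: "x \<in> points \<delta>"
    and sep: "\<And>q y. \<delta> q = Some y \<Longrightarrow> y \<noteq> x \<Longrightarrow> \<exists>n. \<forall>q'. (\<forall>i<n. q' i = q i) \<longrightarrow> \<delta> q' \<noteq> Some x"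
  shows "closed_name \<delta> (late_name \<delta> x t) {x}"
  unfolding closed_name_def function_name_def
proof (intro conjI allI impI)
  show "{x} \<subseteq> points \<delta>" using x by simp
  fix q y assume q: "\<delta> q = Some y"
  let ?p = "late_name \<delta> x t"
  let ?L = "\<lambda>n. LEAST m. ?p (assoc_query q n m) \<noteq> 0"
  have val: "?p (assoc_query q n m) = (if list_encode (n # map q [0..<m]) < t then 1 else if m < n then 0
      else if \<exists>q'. \<delta> q' = Some x \<and> map q' [0..<m] = map q [0..<m] then 1 else 2)" for n m
    by (simp add: late_name_def assoc_query_def)
  have nz: "?p (assoc_query q n n) \<noteq> 0" for n by (simp add: val)
  define r where "r n = ?p (assoc_query q n (?L n)) - 1" for n
  have r: "assoc_fun ?p q = Some r"
    unfolding assoc_fun_def r_def using nz by (auto simp: fun_eq_iff)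
  have "(\<exists>n. r n \<noteq> 0) \<longleftrightarrow> y \<noteq> x"
  proof
    assume "\<exists>n. r n \<noteq> 0"
    then show "y \<noteq> x" using q by (auto simp: r_def val split: if_splits)
  next
    assume "y \<noteq> x"
    then obtain N where N: "\<And>q'. \<forall>i<N. q' i = q i \<Longrightarrow> \<delta> q' \<noteq> Some x" using sep[OF q] by blast
    \<comment> \<open>\<open>N\<close> digits separate \<open>q\<close> from the names of
      \<open>x\<close>; a number of at least \<open>t\<close> makes every query code for it at least
      \<open>t\<close>, beyond the initial default values.\<close>
    define n where "n = max N t"
    have big: "\<not> list_encode (n # map q [0..<m]) < t" for m
      using le_list_encode_Cons[of n] by (smt (verit) n_def leD le_trans max.cobounded2 not_le)
    have "?L n = n"
      using big by (intro Least_equality) (auto simp: val simp del: list_encode.simps split: if_splits)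
    moreover have "\<delta> q' \<noteq> Some x" if "map q' [0..<n] = map q [0..<n]" for q'
      using that N[of q'] by (auto simp: n_def list_eq_iff_nth_eq)
    ultimately have "r n = 1" using big by (auto simp: r_def val simp del: list_encode.simps)
    then show "\<exists>n. r n \<noteq> 0" by (metis zero_neq_one)
  qed
  then show "\<exists>r. assoc_fun ?p q = Some r \<and> sierpinski r = Some (y \<notin> {x})"
    using r by (auto simp: sierpinski_def)
qed

lemma closed_name_late_name_cantor:
  assumes "x \<in> cantor"
  shows "closed_name cantor_repr (late_name cantor_repr x t) {x}"
proof (rule closed_name_late_name)
  show "x \<in> points cantor_repr" using assms by (auto simp: points_def cantor_repr_def)
  fix q y assume "cantor_repr q = Some y" "y \<noteq> x"
  then obtain i where "q i \<noteq> x i" by (auto simp: cantor_repr_def split: if_splits)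
  then have "\<forall>q'. (\<forall>j<Suc i. q' j = q j) \<longrightarrow> cantor_repr q' \<noteq> Some x"
    by (metis cantor_repr_def lessI option.distinct(1) option.inject)
  then show "\<exists>n. \<forall>q'. (\<forall>i<n. q' i = q i) \<longrightarrow> cantor_repr q' \<noteq> Some x" by blast
qed

lemma cube_nameD:
  "cube_name n p x \<Longrightarrow> i < n \<Longrightarrow>
     \<bar>real_of_rat (nat_to_rat_surj (p (prod_encode (i, m)))) - x i\<bar> \<le> 1 / 2 ^ m"
  by (simp add: cube_name_def)

text \<open>Each inequality in \<open>cube_name\<close> concerns a single entry of the name, so a
  violated one shows in a finite prefix.\<close>

lemma closed_name_late_name_cube:
  assumes "x \<in> cube n"
  shows "closed_name (cube_repr n) (late_name (cube_repr n) x t) {x}"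
proof (rule closed_name_late_name)
  show "x \<in> points (cube_repr n)" using assms by (simp add: points_cube_repr)
  fix q y assume q: "cube_repr n q = Some y" "y \<noteq> x"
  have "\<not> cube_name n q x" using q by (auto simp: cube_repr_eq_Some_iff dest: cube_name_unique)
  then obtain i m where "i < n"
      "\<not> \<bar>real_of_rat (nat_to_rat_surj (q (prod_encode (i, m)))) - x i\<bar> \<le> 1 / 2 ^ m"
    using assms by (auto simp: cube_name_def)
  then have "\<forall>q'. (\<forall>j<Suc (prod_encode (i, m)). q' j = q j) \<longrightarrow> cube_repr n q' \<noteq> Some x"
    unfolding cube_repr_eq_Some_iff by (metis cube_nameD lessI)
  then show "\<exists>n'. \<forall>q'. (\<forall>i<n'. q' i = q i) \<longrightarrow> cube_repr n q' \<noteq> Some x" by blast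
qed

section \<open>Convex sets in a cube\<close>

text \<open>With the pointwise structure, \<open>convex\<close>, \<open>span\<close> and
  \<open>independent\<close> apply to the points of a cube, which are functions on all natural
  numbers.\<close>

instantiation "fun" :: (type, real_vector) real_vector
begin

definition scaleR_fun :: "real \<Rightarrow> ('a \<Rightarrow> 'b) \<Rightarrow> 'a \<Rightarrow> 'b" where
  "scaleR_fun c f = (\<lambda>x. c *\<^sub>R f x)"

instance
  by standard (auto simp: scaleR_fun_def fun_eq_iff algebra_simps)

end

lemma scaleR_fun_apply [simp]: "(c *\<^sub>R f) x = c *\<^sub>R f x"
  by (simp add: scaleR_fun_def)

text \<open>Outside the index range both points are \<open>undefined\<close>, and the coefficients
  add up to one.\<close>

lemma convex_comb_cube:
  assumes "x \<in> cube n" "y \<in> cube n"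
  shows "(\<lambda>i\<in>{..<n}. (1 - t) * x i + t * y i) = (1 - t) *\<^sub>R x + t *\<^sub>R y"
proof (rule ext)
  fix i show "(\<lambda>i\<in>{..<n}. (1 - t) * x i + t * y i) i = ((1 - t) *\<^sub>R x + t *\<^sub>R y) i"
    using assms by (cases "i < n") (auto simp: cube_def PiE_def extensional_def algebra_simps)
qed

lemma cube_convex_imp_convex:
  assumes "cube_convex n A" "A \<subseteq> cube n"
  shows "convex A"
  unfolding convex_alt
proof (intro ballI allI impI)
  fix x y and t :: real assume *: "x \<in> A" "y \<in> A" "0 \<le> t \<and> t \<le> 1"
  then have "(\<lambda>i\<in>{..<n}. (1 - t) * x i + t * y i) \<in> A"
    using assms(1) unfolding cube_convex_def by simp
  also have "(\<lambda>i\<in>{..<n}. (1 - t) * x i + t * y i) = (1 - t) *\<^sub>R x + t *\<^sub>R y"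
    using * assms(2) by (intro convex_comb_cube) auto
  finally show "(1 - t) *\<^sub>R x + t *\<^sub>R y \<in> A" .
qed

text \<open>Tychonoff: the cube is a product over all indices whose factors from \<open>n\<close> on
  are single points.\<close>

lemma compact_cube: "compact (cube n)"
proof -
  have "cube n = PiE UNIV (\<lambda>i. if i < n then {0..1} else {undefined :: real})"
    by (auto simp: cube_def PiE_def extensional_def Pi_def split: if_splits)
  moreover have "compactin (product_topology (\<lambda>_. euclidean) UNIV)
      (PiE UNIV (\<lambda>i. if i < n then {0..1} else {undefined :: real}))"
    by (subst compactin_PiE) auto
  ultimately show ?thesis
    by (simp add: euclidean_product_topology flip: compactin_euclidean_iff)
qed

lemma cube_diff_le:
  assumes "x \<in> cube n" "y \<in> cube n"
  shows "\<bar>x i - y i\<bar> \<le> 1"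
proof (cases "i < n")
  case True
  then have "x i \<in> {0..1}" "y i \<in> {0..1}"
    using assms PiE_mem[of _ "{..<n}" "\<lambda>_. {0..1::real}" i] unfolding cube_def by blast+
  then show ?thesis by (simp add: abs_le_iff)
next
  case False
  then have "x i = undefined" "y i = undefined"
    using assms PiE_arb[of _ "{..<n}" _ i] unfolding cube_def by blast+
  then show ?thesis by simp
qed

text \<open>The base point is \<open>undefined\<close> outside the index range, so differences from
  it vanish there and are combinations of \<open>n\<close> unit vectors. This gives the initial
  bound on the dimension.\<close>

lemma cube_subset_span:
  obtains B where "finite B" "card B \<le> n"
    "\<forall>x\<in>cube n. x - (\<lambda>i. if i < n then 0 else undefined) \<in> span B"
proof
  let ?e = "\<lambda>j i::nat. if i = j then 1 else (0::real)"
  show "finite (?e ` {..<n})" "card (?e ` {..<n}) \<le> n"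
    using card_image_le[of "{..<n}" ?e] by auto
  show "\<forall>x\<in>cube n. x - (\<lambda>i. if i < n then 0 else undefined) \<in> span (?e ` {..<n})"
  proof
    fix x assume x: "x \<in> cube n"
    have *: "(\<Sum>j\<in>A. x j *\<^sub>R ?e j) i = (if i \<in> A then x i else 0)" if "finite A" for A i
      using that by induction auto
    have "x - (\<lambda>i. if i < n then 0 else undefined) = (\<Sum>j<n. x j *\<^sub>R ?e j)"
      using x by (intro ext, subst *) (auto simp: cube_def PiE_def extensional_def)
    also have "\<dots> \<in> span (?e ` {..<n})"
      by (intro span_sum span_scale span_base) auto
    finally show "x - (\<lambda>i. if i < n then 0 else undefined) \<in> span (?e ` {..<n})" .
  qed
qed

text \<open>The rational combinations of a spanning set are dense in the relative interior of every
  full-dimensional convex subset.\<close>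

lemma full_dimensional_convex_rational:
  fixes Z :: "'a::real_vector set"
  assumes Z: "convex Z" and B0: "finite B0" and sub: "\<And>z. z \<in> Z \<Longrightarrow> z - v0 \<in> span B0"
    and w0: "w0 \<in> Z" and B: "independent B" "\<And>u. u \<in> B \<Longrightarrow> w0 + u \<in> Z"
    and card: "card B0 \<le> card B" and p: "p \<in> Z" and t: "0 < t" "t \<le> (1::real)"
  shows "\<exists>q y. (\<forall>v\<in>B0. q v \<in> \<rat>) \<and> y \<in> Z \<and>
    v0 + (\<Sum>v\<in>B0. q v *\<^sub>R v) = (1 - t) *\<^sub>R p + t *\<^sub>R y"
proof -
  have BB0: "B \<subseteq> span B0"
  proof
    fix u assume "u \<in> B"
    then have "w0 + u \<in> Z" by (rule B(2))
    from span_diff[OF sub[OF this] sub[OF w0]]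
    show "u \<in> span B0" by simp
  qed
  have finB: "finite B" using independent_span_bound[OF B0 B(1) BB0] by blast
  \<comment> \<open>Otherwise \<open>B\<close> together with \<open>v\<close> would be an
    independent set in \<open>span B0\<close> with more elements than \<open>B0\<close>.\<close>
  have "v \<in> span B" if v: "v \<in> B0" for v
  proof (rule ccontr)
    assume nv: "v \<notin> span B"
    then have "independent (insert v B)" "v \<notin> B"
      using B(1) by (auto simp: independent_insert span_base)
    moreover have "insert v B \<subseteq> span B0" using BB0 v by (auto intro: span_base)
    ultimately show False using independent_span_bound[OF B0, of "insert v B"] finB card by simp
  qed
  then have "\<forall>v\<in>B0. \<exists>m. v = (\<Sum>u\<in>B. m u *\<^sub>R u)"
    using span_finite[OF finB] by auto
  then obtain M where M: "\<And>v. v \<in> B0 \<Longrightarrow> v = (\<Sum>u\<in>B. M v u *\<^sub>R u)" by metis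
  define n where "n = real (card B)"
  \<comment> \<open>The barycentre of the simplex with vertices \<open>w0\<close> and
    \<open>w0 + u\<close> for \<open>u\<close> in \<open>B\<close>.\<close>
  define c where "c = w0 + (\<Sum>u\<in>B. (1 / (n + 1)) *\<^sub>R u)"
  have n: "n \<ge> 0" by (simp add: n_def)
  define D where "D = (\<Sum>u\<in>B. \<Sum>v\<in>B0. \<bar>M v u\<bar>)"
  have D: "D \<ge> 0" unfolding D_def by (intro sum_nonneg) auto
  \<comment> \<open>With this accuracy in the coordinates for \<open>B0\<close>, the coordinates for
    \<open>B\<close> change by at most \<open>t / (n + 1)\<^sup>2\<close>. After division by
    \<open>t\<close> this leaves all weights at the barycentre nonnegative with sum at most 1. The
    summand 1 covers the case \<open>D = 0\<close>.\<close>
  define \<delta> where "\<delta> = t / ((n + 1)\<^sup>2 * (1 + D))"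
  have \<delta>: "\<delta> > 0" using t n D by (simp add: \<delta>_def add_nonneg_pos)
  define g where "g = (1 - t) *\<^sub>R p + t *\<^sub>R c"
  have comb: "w0 + (\<Sum>u\<in>B. a u *\<^sub>R u) \<in> Z" if a: "\<And>u. u \<in> B \<Longrightarrow> 0 \<le> a u" "sum a B \<le> 1" for a
  proof -
    \<comment> \<open>The index 0 stands for the vertex \<open>w0\<close>; it is not in
      \<open>B\<close>, since \<open>B\<close> is independent.\<close>
    have *: "(\<Sum>u\<in>insert 0 B. (if u = 0 then 1 - sum a B else a u) *\<^sub>R (w0 + u)) \<in> Z"
    proof (rule convex_sum[OF _ Z])
      have "0 \<notin> B" using B(1) dependent_zero by blast
      then have "(\<Sum>i\<in>B. if i = 0 then 1 - sum a B else a i) = sum a B" by (intro sum.cong) auto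
      then show "(\<Sum>i\<in>insert 0 B. if i = 0 then 1 - sum a B else a i) = 1"
        using finB \<open>0 \<notin> B\<close> by simp
    qed (use a finB w0 B in auto)
    moreover have "0 \<notin> B" using B(1) dependent_zero by blast
    then have "(\<Sum>u\<in>insert 0 B. (if u = 0 then 1 - sum a B else a u) *\<^sub>R (w0 + u))
        = (1 - sum a B) *\<^sub>R w0 + (\<Sum>u\<in>B. a u *\<^sub>R (w0 + u))"
      using finB by (auto intro!: sum.cong)
    also have "\<dots> = w0 + (\<Sum>u\<in>B. a u *\<^sub>R u)"
      by (simp add: scaleR_add_right sum.distrib scaleR_left_diff_distrib flip: scaleR_sum_left)
    finally show ?thesis using * by metis
  qed
  have "c \<in> Z"
    unfolding c_def
  proof (rule comb)
    have "(\<Sum>u\<in>B. 1 / (n + 1)) = n / (n + 1)" by (simp add: n_def)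
    also have "\<dots> \<le> 1" using n by simp
    finally show "(\<Sum>u\<in>B. 1 / (n + 1)) \<le> 1" .
  qed (use n in simp)
  then have "(1 - t) *\<^sub>R p + t *\<^sub>R c \<in> Z"
    using convexD_alt[OF Z p, of c t] t by simp
  then have "g - v0 \<in> span B0" unfolding g_def by (rule sub)
  then have "g - v0 \<in> range (\<lambda>c. \<Sum>v\<in>B0. c v *\<^sub>R v)" by (simp only: span_finite[OF B0])
  then obtain \<gamma> where \<gamma>: "g - v0 = (\<Sum>v\<in>B0. \<gamma> v *\<^sub>R v)" by (rule rangeE)
  have "\<exists>q\<in>\<rat>. \<bar>q - \<gamma> v\<bar> < \<delta>" for v
  proof -
    obtain q where "q \<in> \<rat>" "\<gamma> v - \<delta> < q" "q < \<gamma> v + \<delta>"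
      using Rats_dense_in_real[of "\<gamma> v - \<delta>" "\<gamma> v + \<delta>"] \<delta> by auto
    then show ?thesis by (intro bexI[of _ q]) auto
  qed
  then obtain q where q: "\<And>v. q v \<in> \<rat>" "\<And>v. \<bar>q v - \<gamma> v\<bar> < \<delta>" by metis
  define e where "e u = (\<Sum>v\<in>B0. (q v - \<gamma> v) * M v u)" for u
  \<comment> \<open>The whole error is moved into the endpoint \<open>y\<close>, whose weight is
    \<open>t\<close>; hence the division by \<open>t\<close>.\<close>
  define a where "a u = 1 / (n + 1) + e u / t" for u
  have e: "\<bar>e u\<bar> \<le> t / (n + 1)\<^sup>2" if u: "u \<in> B" for u
  proof -
    have "\<bar>e u\<bar> \<le> (\<Sum>v\<in>B0. \<bar>(q v - \<gamma> v) * M v u\<bar>)" unfolding e_def by (rule sum_abs)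
    also have "\<dots> \<le> (\<Sum>v\<in>B0. \<delta> * \<bar>M v u\<bar>)"
      unfolding abs_mult by (intro sum_mono mult_right_mono less_imp_le q(2) abs_ge_zero)
    also have "\<dots> = \<delta> * (\<Sum>v\<in>B0. \<bar>M v u\<bar>)" by (simp add: sum_distrib_left)
    also have "\<dots> \<le> \<delta> * (1 + D)"
    proof -
      have "(\<Sum>v\<in>B0. \<bar>M v u\<bar>) \<le> D" unfolding D_def
        using u finB by (intro member_le_sum[of u B "\<lambda>u. \<Sum>v\<in>B0. \<bar>M v u\<bar>"] sum_nonneg) auto
      then show ?thesis using \<delta> by (intro mult_left_mono) auto
    qed
    also have "\<dots> = t / (n + 1)\<^sup>2" using D by (simp add: \<delta>_def)
    finally show ?thesis .
  qed
  have et: "\<bar>e u / t\<bar> \<le> 1 / (n + 1)\<^sup>2" if "u \<in> B" for u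
    using e[OF that] t divide_right_mono[of "\<bar>e u\<bar>" "t / (n + 1)\<^sup>2" t] by (simp add: abs_divide)
  have le: "1 / (n + 1)\<^sup>2 \<le> 1 / (n + 1)" 
  proof -
    have "n + 1 \<le> (n + 1)\<^sup>2" using n by (simp add: power2_eq_square algebra_simps)
    then show ?thesis using n by (intro divide_left_mono mult_pos_pos) auto
  qed
  have "0 \<le> a u" if "u \<in> B" for u
    using et[OF that] le unfolding a_def by linarith
  moreover have "sum a B \<le> 1"
  proof -
    have "sum a B \<le> (\<Sum>u\<in>B. 1 / (n + 1) + 1 / (n + 1)\<^sup>2)"
      unfolding a_def using et by (intro sum_mono add_left_mono) (rule abs_le_D1)
    also have "\<dots> = n * (1 / (n + 1) + 1 / (n + 1)\<^sup>2)" by (simp add: n_def)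
    also have "\<dots> = 1 - 1 / (n + 1)\<^sup>2"
    proof -
      have "(m - 1) * (1 / m + 1 / m\<^sup>2) = 1 - 1 / m\<^sup>2" if "m > 0" for m :: real
        using that by (simp add: field_simps power2_eq_square)
      from this[of "n + 1"] n show ?thesis by simp
    qed
    also have "\<dots> \<le> 1" by simp
    finally show ?thesis .
  qed
  ultimately have y: "w0 + (\<Sum>u\<in>B. a u *\<^sub>R u) \<in> Z" by (rule comb)
  have "v0 + (\<Sum>v\<in>B0. q v *\<^sub>R v) = g + (\<Sum>v\<in>B0. (q v - \<gamma> v) *\<^sub>R v)"
    using \<gamma> by (simp add: scaleR_left_diff_distrib sum_subtractf algebra_simps)
  also have "(\<Sum>v\<in>B0. (q v - \<gamma> v) *\<^sub>R v) = (\<Sum>v\<in>B0. \<Sum>u\<in>B. ((q v - \<gamma> v) * M v u) *\<^sub>R u)"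
  proof (rule sum.cong[OF refl])
    fix v assume "v \<in> B0"
    from M[OF this] have "(q v - \<gamma> v) *\<^sub>R v = (q v - \<gamma> v) *\<^sub>R (\<Sum>u\<in>B. M v u *\<^sub>R u)" by simp
    then show "(q v - \<gamma> v) *\<^sub>R v = (\<Sum>u\<in>B. ((q v - \<gamma> v) * M v u) *\<^sub>R u)"
      by (simp add: scaleR_sum_right)
  qed
  also have "\<dots> = (\<Sum>u\<in>B. e u *\<^sub>R u)"
    unfolding e_def scaleR_sum_left by (rule sum.swap)
  also have "\<dots> = t *\<^sub>R (\<Sum>u\<in>B. (e u / t) *\<^sub>R u)" using t by (simp add: scaleR_sum_right)
  also have "g + \<dots> = (1 - t) *\<^sub>R p + t *\<^sub>R (w0 + (\<Sum>u\<in>B. a u *\<^sub>R u))"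
    by (simp add: g_def c_def a_def scaleR_add_left sum.distrib scaleR_add_right)
  finally show ?thesis using q(1) y by blast
qed

text \<open>Otherwise every \<^term>\<open>Z b\<close> would contain, within \<^term>\<open>U\<close>, a point of one and the same
  countable set.\<close>

lemma lower_dimensional_convex:
  fixes Z :: "real \<Rightarrow> (nat \<Rightarrow> real) set"
  assumes cube: "\<And>b. b \<in> {0..1} \<Longrightarrow> Z b \<subseteq> cube k"
    and convex: "\<And>b. b \<in> {0..1} \<Longrightarrow> convex (Z b)"
    and B0: "finite B0" and sub: "\<And>b z. b \<in> {0..1} \<Longrightarrow> z \<in> Z b \<Longrightarrow> z - v0 \<in> span B0"
    and meet: "\<And>b. b \<in> {0..1} \<Longrightarrow> Z b \<inter> U \<noteq> {}"
    and nbhd: "\<And>b z zs. b \<in> {0..1} \<Longrightarrow> z \<in> Z b \<inter> U \<Longrightarrow> range zs \<subseteq> Z b \<Longrightarrow> zs \<longlonglongrightarrow> z \<Longrightarrow>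
      \<exists>j. zs j \<in> U"
    and disj: "\<And>b b'. b \<in> {0..1} \<Longrightarrow> b' \<in> {0..1} \<Longrightarrow> b \<noteq> b' \<Longrightarrow> Z b \<inter> Z b' \<inter> U = {}"
  obtains b w B where "b \<in> {0..1}" "finite B" "card B < card B0" "\<And>z. z \<in> Z b \<Longrightarrow> z - w \<in> span B"
proof (rule ccontr)
  note witness = that
  assume contra: "\<not> thesis"
  let ?X = "(\<lambda>q. v0 + (\<Sum>v\<in>B0. q v *\<^sub>R v)) ` (PiE B0 (\<lambda>_. \<rat>))"
  have "\<exists>x. x \<in> ?X \<inter> Z b \<inter> U" if b: "b \<in> {0..1}" for b
  proof -
    obtain w0 where w0: "w0 \<in> Z b" "w0 \<in> U" using meet[OF b] by blast
    obtain B where B: "B \<subseteq> (\<lambda>z. z - w0) ` Z b" "independent B" "(\<lambda>z. z - w0) ` Z b \<subseteq> span B"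
      using maximal_independent_subset by blast
    have "B \<subseteq> span B0"
    proof
      fix u assume "u \<in> B"
      then obtain z where "z \<in> Z b" "u = z - w0" using B by blast
      then have "(z - v0) - (w0 - v0) \<in> span B0"
        using span_diff[OF sub[OF b \<open>z \<in> Z b\<close>] sub[OF b w0(1)]] by simp
      then show "u \<in> span B0" using \<open>u = z - w0\<close> by simp
    qed
    then have "finite B" using independent_span_bound[OF B0 B(2)] by blast
    \<comment> \<open>A smaller \<open>B\<close> would be a witness for the conclusion, with base
      point \<open>w0\<close>.\<close>
    then have card: "card B0 \<le> card B" using contra witness[OF b \<open>finite B\<close>, of w0] B(3) by force
    have *: "\<exists>q y. (\<forall>v\<in>B0. q v \<in> \<rat>) \<and> y \<in> Z b \<and>
      v0 + (\<Sum>v\<in>B0. q v *\<^sub>R v) = (1 - t) *\<^sub>R w0 + t *\<^sub>R y" if "0 < t" "t \<le> 1" for t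
      using B that
      by (intro full_dimensional_convex_rational[OF convex[OF b] B0 sub[OF b] w0(1) B(2) _ card w0(1)]) auto
    have "\<forall>j. \<exists>q y. (\<forall>v\<in>B0. q v \<in> \<rat>) \<and> y \<in> Z b \<and> v0 + (\<Sum>v\<in>B0. q v *\<^sub>R v)
        = (1 - inverse (real (Suc j))) *\<^sub>R w0 + inverse (real (Suc j)) *\<^sub>R y"
      by (rule allI, rule *) (simp_all add: field_simps)
    then obtain q y where qy: "\<And>j. \<forall>v\<in>B0. q j v \<in> \<rat>" "\<And>j. y j \<in> Z b"
      "\<And>j. v0 + (\<Sum>v\<in>B0. q j v *\<^sub>R v)
        = (1 - inverse (real (Suc j))) *\<^sub>R w0 + inverse (real (Suc j)) *\<^sub>R y j"
      unfolding choice_iff by blast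
    \<comment> \<open>These points of the countable set stay in \<open>Z b\<close> by convexity and
      tend to \<open>w0\<close>, so one of them lies in \<open>U\<close>.\<close>
    define x where "x j = (1 - inverse (real (Suc j))) *\<^sub>R w0 + inverse (real (Suc j)) *\<^sub>R y j" for j
    have xZ: "x j \<in> Z b" for j
      using convex[OF b, unfolded convex_alt] w0(1) qy(2)[of j]
      unfolding x_def by (simp del: of_nat_Suc add: inverse_le_1_iff)
    have xX: "x j \<in> ?X" for j
    proof (rule image_eqI)
      show "x j = v0 + (\<Sum>v\<in>B0. restrict (q j) B0 v *\<^sub>R v)" by (simp add: x_def qy(3))
    qed (use qy(1) in auto)
    have "(\<lambda>j. x j i) \<longlonglongrightarrow> w0 i" for i
    proof -
      have "\<bar>y j i - w0 i\<bar> \<le> 1" for j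
        using cube_diff_le[of "y j" k w0] cube[OF b] qy(2)[of j] w0(1) by auto
      moreover have "x j i - w0 i = inverse (real (Suc j)) * (y j i - w0 i)" for j
        by (simp add: x_def algebra_simps del: of_nat_Suc)
      ultimately have "norm (x j i - w0 i) \<le> inverse (real (Suc j))" for j
        using mult_left_mono[of "\<bar>y j i - w0 i\<bar>" 1 "inverse (real (Suc j))"]
        by (simp add: abs_mult del: of_nat_Suc)
      then have "(\<lambda>j. x j i - w0 i) \<longlonglongrightarrow> 0"
        by (intro Lim_null_comparison[OF always_eventually LIMSEQ_inverse_real_of_nat] allI)
      then show ?thesis by (rule LIM_zero_cancel)
    qed
    then have "x \<longlonglongrightarrow> w0" by (simp add: tendsto_fun_iff)
    then obtain j where "x j \<in> U" using nbhd[OF b, of w0 x] w0 xZ by blast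
    then show ?thesis using xX xZ by blast
  qed
  then have "\<forall>b\<in>{0..1}. \<exists>x. x \<in> ?X \<inter> Z b \<inter> U" by (rule ballI)
  from bchoice[OF this] obtain x where "\<forall>b\<in>{0..1}. x b \<in> ?X \<inter> Z b \<inter> U" ..
  then have x: "x b \<in> ?X \<inter> Z b \<inter> U" if "b \<in> {0..1}" for b using that by (rule bspec)
  \<comment> \<open>Within \<open>U\<close> the sets \<open>Z b\<close> are pairwise disjoint, so
    the chosen points would embed the unit interval into a countable set.\<close>
  have "inj_on x {0..1}"
  proof (rule inj_onI, rule ccontr)
    fix b b' :: real assume b: "b \<in> {0..1}" "b' \<in> {0..1}" "x b = x b'" "b \<noteq> b'"
    then have "x b \<in> Z b \<inter> Z b' \<inter> U" using x[of b] x[of b'] by auto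
    then show False using disj[of b b'] b by blast
  qed
  moreover have "countable ?X" by (rule countable_image) (rule countable_PiE[OF B0 countable_rat])
  then have "countable (x ` {0..1})" by (rule countable_subset[rotated]) (use x in blast)
  ultimately have "countable {0..1::real}" by (metis countable_image_inj_eq)
  then show False using uncountable_closed_interval[of 0 1] by simp
qed

section \<open>Approximating names\<close>

definition strict_name :: "nat \<Rightarrow> baire \<Rightarrow> (nat \<Rightarrow> real) \<Rightarrow> bool" where
  "strict_name n p x \<longleftrightarrow> x \<in> cube n \<and>
     (\<forall>i<n. \<forall>m. \<bar>real_of_rat (nat_to_rat_surj (p (prod_encode (i, m)))) - x i\<bar> < 1 / 2 ^ m)"

lemma strict_name_imp_cube_name: "strict_name n p x \<Longrightarrow> cube_name n p x"
  by (auto simp: strict_name_def cube_name_def intro: less_imp_le)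

lemma rat_code_approx: "e > 0 \<Longrightarrow> \<exists>c. \<bar>real_of_rat (nat_to_rat_surj c) - a\<bar> < e"
proof -
  assume "e > 0"
  then obtain q where q: "a < of_rat q" "of_rat q < a + e" using of_rat_dense[of a "a + e"] by auto
  obtain c where "q = nat_to_rat_surj c" using surj_nat_to_rat_surj by blast
  then show ?thesis using q by (intro exI[of _ c]) auto
qed

lemma strict_name_exists:
  assumes "x \<in> cube n"
  obtains p where "strict_name n p x"
proof -
  have "\<forall>i m. \<exists>c. \<bar>real_of_rat (nat_to_rat_surj c) - x i\<bar> < 1 / 2 ^ m"
    by (intro allI rat_code_approx) simp
  then obtain c where "\<And>i m. \<bar>real_of_rat (nat_to_rat_surj (c i m)) - x i\<bar> < 1 / 2 ^ (m :: nat)"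
    by metis
  then have "strict_name n (\<lambda>j. case prod_decode j of (i, m) \<Rightarrow> c i m) x"
    using assms by (simp add: strict_name_def)
  then show ?thesis by (rule that)
qed

text \<open>This fails for arbitrary names, because \<^term>\<open>z\<close> may be an endpoint of one of the closed
  intervals that its name describes.\<close>

lemma strict_name_approx:
  assumes r: "strict_name n r z" and zs: "\<And>j. zs j \<in> cube n" "zs \<longlonglongrightarrow> z"
  obtains R where "\<And>j. strict_name n (R j) (zs j)" "R \<longlonglongrightarrow> r"
proof -
  let ?ok = "\<lambda>x i m c. \<bar>real_of_rat (nat_to_rat_surj c) - x i\<bar> < 1 / 2 ^ m"
  have "\<forall>j. \<exists>p. strict_name n p (zs j)" using strict_name_exists[OF zs(1)] by blast
  then obtain p where p: "\<And>j. strict_name n (p j) (zs j)"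
    by metis
  \<comment> \<open>Entries of \<open>r\<close> are kept where they are valid for
    \<open>zs j\<close>. By strictness each entry is valid for all large \<open>j\<close>.\<close>
  define R where "R j = (\<lambda>c. case prod_decode c of (i, m) \<Rightarrow>
    if i < n \<and> \<not> ?ok (zs j) i m (r c) then p j c else r c)" for j
  have "strict_name n (R j) (zs j)" for j
    using zs(1) p[of j] by (auto simp: strict_name_def R_def)
  moreover have "R \<longlonglongrightarrow> r"
    unfolding tendsto_baire_iff
  proof
    fix c
    obtain i m where c: "prod_decode c = (i, m)" by (cases "prod_decode c")
    show "eventually (\<lambda>j. R j c = r c) sequentially"
    proof (cases "i < n")
      case True
      have "?ok z i m (r c)"
        using r True c by (auto simp: strict_name_def) (metis prod_decode_inverse)
      moreover have "(\<lambda>j. \<bar>real_of_rat (nat_to_rat_surj (r c)) - zs j i\<bar>)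
          \<longlonglongrightarrow> \<bar>real_of_rat (nat_to_rat_surj (r c)) - z i\<bar>"
        using zs(2) by (intro tendsto_intros) (simp add: tendsto_fun_iff)
      ultimately have "eventually (\<lambda>j. ?ok (zs j) i m (r c)) sequentially"
        by (rule order_tendstoD(2)[rotated])
      then show ?thesis by eventually_elim (simp add: R_def c)
    qed (simp add: R_def c)
  qed
  ultimately show ?thesis by (rule that)
qed

section \<open>Limits of sequences of sets\<close>

text \<open>Painleve-Kuratowski convergence: \<open>Z\<close> is contained in the lower limit and
  contains the upper limit.\<close>

definition set_limit :: "(nat \<Rightarrow> 'a::topological_space set) \<Rightarrow> 'a set \<Rightarrow> bool" where
  "set_limit Cs Z \<longleftrightarrow> (\<forall>z\<in>Z. \<exists>zs. (\<forall>j. zs j \<in> Cs j) \<and> zs \<longlonglongrightarrow> z) \<and>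
     (\<forall>\<phi> zs z. strict_mono \<phi> \<and> (\<forall>j. zs j \<in> Cs (\<phi> j)) \<and> zs \<longlonglongrightarrow> z \<longrightarrow> z \<in> Z)"

lemma compact_binary_sequences: "compact (PiE UNIV (\<lambda>_. {0, 1}) :: baire set)"
proof -
  have "compactin (product_topology (\<lambda>_. euclidean) UNIV) (PiE UNIV (\<lambda>_. {0, 1}) :: baire set)"
    by (subst compactin_PiE) (auto intro: finite_imp_compact)
  then show ?thesis by (simp add: euclidean_product_topology flip: compactin_euclidean_iff)
qed

text \<open>Diagonalise over a countable basis: whether a basic open set meets the sets in question should
  eventually not depend on the index.\<close>

lemma set_limit_subsequence:
  fixes Cs :: "nat \<Rightarrow> 'a::{metric_space, second_countable_topology} set"
  assumes ne: "\<And>j. Cs j \<noteq> {}"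
  obtains \<phi> Z where "strict_mono \<phi>" "set_limit (\<lambda>j. Cs (\<phi> j)) Z"
proof -
  obtain \<B> :: "'a set set" where \<B>: "countable \<B>" "topological_basis \<B>"
    using ex_countable_basis by auto
  define U where "U = from_nat_into \<B>"
  have basis: "\<exists>i. open (U i) \<and> z \<in> U i \<and> U i \<subseteq> ball z e" if "e > 0" for z e
  proof -
    obtain B where "B \<in> \<B>" "z \<in> B" "B \<subseteq> ball z e"
      using topological_basisE[OF \<B>(2) open_ball[of z e], of z] \<open>e > 0\<close> by auto
    moreover obtain i where "U i = B" using from_nat_into_surj[OF \<B>(1) \<open>B \<in> \<B>\<close>] by (auto simp: U_def)
    moreover have "open B" using topological_basis_open[OF \<B>(2) \<open>B \<in> \<B>\<close>] .
    ultimately show ?thesis by blast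
  qed
  define f where "f j = (\<lambda>i. if U i \<inter> Cs j = {} then 0 else 1 :: nat)" for j
  have "\<forall>j. f j \<in> PiE UNIV (\<lambda>_. {0, 1})" by (auto simp: f_def)
  \<comment> \<open>Sequential compactness of Cantor space performs the diagonalisation.\<close>
  then obtain l \<phi> where \<phi>: "strict_mono \<phi>" "(f \<circ> \<phi>) \<longlonglongrightarrow> l"
    using seq_compactE[OF compact_imp_seq_compact[OF compact_binary_sequences]] by metis
  define Z where "Z = {z. \<exists>zs. (\<forall>j. zs j \<in> Cs (\<phi> j)) \<and> zs \<longlonglongrightarrow> z}"
  have "z \<in> Z" if \<psi>: "strict_mono \<psi>" and zs: "\<And>j. zs j \<in> Cs (\<phi> (\<psi> j))" "zs \<longlonglongrightarrow> z" for \<psi> zs z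
  proof -
    have "eventually (\<lambda>j. infdist z (Cs (\<phi> j)) < e) sequentially" if e: "e > 0" for e
    proof -
      obtain i where i: "open (U i)" "z \<in> U i" "U i \<subseteq> ball z e" using basis[OF e] by blast
      have 1: "eventually (\<lambda>j. zs j \<in> U i) sequentially"
        using topological_tendstoD[OF zs(2) i(1,2)] .
      have ev: "eventually (\<lambda>j. f (\<phi> j) i = l i) sequentially"
        using \<phi>(2) by (simp add: tendsto_baire_iff)
      have "eventually (\<lambda>j. f (\<phi> (\<psi> j)) i = l i) sequentially"
        using eventually_subseq[OF \<psi> ev] by simp
      from eventually_happens[OF eventually_conj[OF 1 this]] obtain j
        where "zs j \<in> U i" "f (\<phi> (\<psi> j)) i = l i" by auto
      moreover from this zs(1)[of j] have "U i \<inter> Cs (\<phi> (\<psi> j)) \<noteq> {}" by blast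
      \<comment> \<open>One late index at which \<open>U i\<close> meets the set determines the
        limit digit, so \<open>U i\<close> meets all but finitely many of the sets.\<close>
      ultimately have li: "l i = 1" by (simp only: f_def if_False)
      from ev show ?thesis
      proof eventually_elim
        case (elim j)
        have "U i \<inter> Cs (\<phi> j) \<noteq> {}"
        proof
          assume "U i \<inter> Cs (\<phi> j) = {}"
          then have "f (\<phi> j) i = 0" by (simp add: f_def)
          with elim li show False by simp
        qed
        then obtain y where "y \<in> U i" "y \<in> Cs (\<phi> j)" by blast
        then show ?case using i(3) infdist_le[of y "Cs (\<phi> j)" z] by (auto simp: subset_iff)
      qed
    qed
    then have inf: "(\<lambda>j. infdist z (Cs (\<phi> j))) \<longlonglongrightarrow> 0"
      by (intro order_tendstoI) (auto intro: always_eventually less_le_trans[OF _ infdist_nonneg])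
    \<comment> \<open>The sets need not be closed, so the distance may not be attained; a vanishing
      slack is allowed.\<close>
    have "\<forall>j. \<exists>y\<in>Cs (\<phi> j). dist z y < infdist z (Cs (\<phi> j)) + inverse (real (Suc j))"
    proof
      fix j
      have "Inf (dist z ` Cs (\<phi> j)) < infdist z (Cs (\<phi> j)) + inverse (real (Suc j))"
        using ne by (simp add: infdist_def)
      then show "\<exists>y\<in>Cs (\<phi> j). dist z y < infdist z (Cs (\<phi> j)) + inverse (real (Suc j))"
        using cInf_lessD[of "dist z ` Cs (\<phi> j)"] ne by blast
    qed
    then obtain y where y: "\<And>j. y j \<in> Cs (\<phi> j)"
      "\<And>j. dist z (y j) < infdist z (Cs (\<phi> j)) + inverse (real (Suc j))" by metis
    have lim: "(\<lambda>j. infdist z (Cs (\<phi> j)) + inverse (real (Suc j))) \<longlonglongrightarrow> 0"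
      using tendsto_add[OF inf LIMSEQ_inverse_real_of_nat] by simp
    have "\<forall>j. norm (dist (y j) z) \<le> infdist z (Cs (\<phi> j)) + inverse (real (Suc j))"
      using y(2) by (simp add: dist_commute less_imp_le)
    then have "(\<lambda>j. dist (y j) z) \<longlonglongrightarrow> 0"
      by (rule Lim_null_comparison[OF always_eventually lim])
    then have "y \<longlonglongrightarrow> z" by (rule tendsto_dist_iff[THEN iffD2])
    then show ?thesis using y(1) by (auto simp: Z_def)
  qed
  then have "set_limit (\<lambda>j. Cs (\<phi> j)) Z" by (auto simp: set_limit_def Z_def)
  then show ?thesis by (rule that[OF \<phi>(1)])
qed

section \<open>Instances\<close>

definition unit_point :: "real \<Rightarrow> nat \<Rightarrow> real" where
  "unit_point b = (\<lambda>i\<in>{..<1}. b)"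

lemma unit_point_cube: "b \<in> {0..1} \<Longrightarrow> unit_point b \<in> cube 1"
  by (auto simp: unit_point_def cube_def)

lemma unit_point_inject [simp]: "unit_point b = unit_point b' \<longleftrightarrow> b = b'"
  by (auto simp: unit_point_def fun_eq_iff)

text \<open>A value \<^term>\<open>None\<close> stands for a closed set from which nothing has been removed.\<close>

definition instance_name :: "baire option \<Rightarrow> (nat \<Rightarrow> real option) \<Rightarrow> baire \<Rightarrow> bool" where
  "instance_name \<alpha> \<beta> p \<longleftrightarrow>
     (\<alpha> = None \<longrightarrow> slice p 0 = (\<lambda>_. 1)) \<and>
     (\<forall>x. \<alpha> = Some x \<longrightarrow> x \<in> cantor \<and> closed_name cantor_repr (slice p 0) {x}) \<and>
     (\<forall>i. \<beta> i = None \<longrightarrow> slice p (Suc i) = (\<lambda>_. 1)) \<and>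
     (\<forall>i b. \<beta> i = Some b \<longrightarrow>
        b \<in> {0..1} \<and> closed_name (cube_repr 1) (slice p (Suc i)) {unit_point b})"

lemma instance_name_const: "instance_name None Map.empty (\<lambda>_. 1)"
  by (simp add: instance_name_def slice_def[abs_def])

text \<open>The slice was constant 1 so far, and a late name of the point begins with as many ones
  as desired; hence the first \<open>N\<close> entries do not change.\<close>

lemma instance_name_reveal_point:
  assumes "instance_name \<alpha> \<beta> p" "\<beta> i = None" "b \<in> {0..1}"
  obtains p' where "instance_name \<alpha> (\<beta>(i \<mapsto> b)) p'" "\<And>n. n < N \<Longrightarrow> p' n = p n"
proof
  let ?a = "late_name (cube_repr 1) (unit_point b) N"
  show "instance_name \<alpha> (\<beta>(i \<mapsto> b)) (put_slice (Suc i) ?a p)"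
    using assms closed_name_late_name_cube[OF unit_point_cube]
    by (auto simp: instance_name_def slice_put_slice split: if_splits)
  show "put_slice (Suc i) ?a p n = p n" if "n < N" for n
    using assms(1,2) that
    by (intro put_slice_agree) (auto simp: instance_name_def late_name_agree)
qed

lemma instance_name_reveal_branch:
  assumes "instance_name None \<beta> p" "x \<in> cantor"
  obtains p' where "instance_name (Some x) \<beta> p'" "\<And>n. n < N \<Longrightarrow> p' n = p n"
proof
  let ?a = "late_name cantor_repr x N"
  show "instance_name (Some x) \<beta> (put_slice 0 ?a p)"
    using assms closed_name_late_name_cantor
    by (auto simp: instance_name_def slice_put_slice split: if_splits)
  show "put_slice 0 ?a p n = p n" if "n < N" for n
    using assms that
    by (intro put_slice_agree) (auto simp: instance_name_def late_name_agree)
qed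

lemma ones_eventually:
  assumes "Q \<longlonglongrightarrow> q"
  shows "eventually (\<lambda>j. ones k (Q j) = ones k q) sequentially"
proof -
  have "eventually (\<lambda>j. \<forall>i\<in>{..<k}. Q j i = q i) sequentially"
    using assms by (intro eventually_ball_finite) (auto simp: tendsto_baire_iff)
  then show ?thesis by eventually_elim (simp add: ones_def)
qed

section \<open>The adversary argument\<close>

text \<open>What a reduction to \<open>XC k\<close> provides, with computability weakened to
  continuity: \<open>C p\<close> is the convex set queried on instance \<open>p\<close>, and from a
  name \<open>r\<close> of a point of it the reduction computes the branch \<open>Q p r\<close> and
  a name \<open>S p r\<close> of the value.\<close>

locale xc_reduction =
  fixes k :: nat and C :: "baire \<Rightarrow> (nat \<Rightarrow> real) set" and Q S :: "baire \<Rightarrow> baire \<Rightarrow> baire"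
    and V :: "baire set"
  assumes instance_V: "instance_name \<alpha> \<beta> p \<Longrightarrow> p \<in> V"
    and C_nonempty: "p \<in> V \<Longrightarrow> C p \<noteq> {}"
    and C_cube: "p \<in> V \<Longrightarrow> C p \<subseteq> cube k"
    and C_convex: "p \<in> V \<Longrightarrow> convex (C p)"
    and C_closed: "(\<And>j. P j \<in> V) \<Longrightarrow> p \<in> V \<Longrightarrow> P \<longlonglongrightarrow> p \<Longrightarrow> (\<And>j. zs j \<in> C (P j)) \<Longrightarrow>
      zs \<longlonglongrightarrow> z \<Longrightarrow> z \<in> C p"
    and QS_continuous: "(\<And>j. P j \<in> V) \<Longrightarrow> p \<in> V \<Longrightarrow> P \<longlonglongrightarrow> p \<Longrightarrow>
      (\<And>j. zs j \<in> C (P j)) \<Longrightarrow> (\<And>j. cube_name k (R j) (zs j)) \<Longrightarrow>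
      z \<in> C p \<Longrightarrow> cube_name k r z \<Longrightarrow> R \<longlonglongrightarrow> r \<Longrightarrow>
      (\<lambda>j. Q (P j) (R j)) \<longlonglongrightarrow> Q p r \<and> (\<lambda>j. S (P j) (R j)) \<longlonglongrightarrow> S p r"
    and Q_correct: "instance_name (Some x) \<beta> p \<Longrightarrow> z \<in> C p \<Longrightarrow> cube_name k r z \<Longrightarrow> Q p r = x"
    and S_correct: "instance_name \<alpha> \<beta> p \<Longrightarrow> z \<in> C p \<Longrightarrow> cube_name k r z \<Longrightarrow>
      \<beta> (ones k (Q p r)) = Some b \<Longrightarrow> cube_name 1 (S p r) (unit_point b)"
begin

section \<open>Solution sets close to the unrestricted instance\<close>

abbreviation I0 :: baire where "I0 \<equiv> (\<lambda>_. 1)"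

lemma I0_V: "I0 \<in> V"
  using instance_V[OF instance_name_const] .

text \<open>All instances of the sequence carry the restrictions \<open>\<beta>\<close>, but reveal
  them later and later, so that they tend to \<open>I0\<close>.\<close>

definition approachable :: "(nat \<Rightarrow> real option) \<Rightarrow> (nat \<Rightarrow> real) set \<Rightarrow> bool" where
  "approachable \<beta> Z \<longleftrightarrow>
     (\<exists>P. (\<forall>j. instance_name None \<beta> (P j)) \<and> P \<longlonglongrightarrow> I0 \<and> set_limit (\<lambda>j. C (P j)) Z)"

text \<open>Strict names make this set relatively open in \<open>C I0\<close>. A point may lie in
  several branches, since the output may depend on the name.\<close>

definition branch :: "nat \<Rightarrow> (nat \<Rightarrow> real) set" where
  "branch i = {z \<in> C I0. \<exists>r. strict_name k r z \<and> ones k (Q I0 r) = i}"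

text \<open>Upper semicontinuity of the solution sets: by compactness, solutions of instances
  tending to \<open>p\<close> that stay away from \<open>C p\<close> would accumulate at a point
  which \<open>C_closed\<close> puts into \<open>C p\<close>.\<close>

lemma C_close:
  assumes p: "p \<in> V" and e: "e > 0"
    and near: "\<And>N. \<exists>p'\<in>V. \<Phi> p' \<and> (\<forall>n<N. p' n = p n)"
  shows "\<exists>p'\<in>V. \<Phi> p' \<and> (\<forall>n<N. p' n = p n) \<and> (\<forall>z\<in>C p'. \<exists>z'\<in>C p. dist z z' < e)"
proof (rule ccontr)
  assume contra: "\<not> ?thesis"
  have "\<exists>p' z. p' \<in> V \<and> (\<forall>n<j. p' n = p n) \<and> z \<in> C p' \<and> (\<forall>z'\<in>C p. e \<le> dist z z')" for j
  proof -
    \<comment> \<open>Agreement up to \<open>N\<close> makes \<open>p'\<close> a candidate for the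
      claim, agreement up to \<open>j\<close> makes the sequence converge to
      \<open>p\<close>.\<close>
    obtain p' where p': "p' \<in> V" "\<Phi> p'" "\<forall>n<max N j. p' n = p n" using near by blast
    with contra obtain z where "z \<in> C p'" "\<forall>z'\<in>C p. e \<le> dist z z'" by (force simp: not_less)
    then show ?thesis using p' by (intro exI[of _ p'] exI[of _ z]) auto
  qed
  then obtain P zs where P: "\<And>j. P j \<in> V" "\<And>j n. n < j \<Longrightarrow> P j n = p n"
    and zs: "\<And>j. zs j \<in> C (P j)" "\<And>j z'. z' \<in> C p \<Longrightarrow> e \<le> dist (zs j) z'" by metis
  have "\<forall>j. zs j \<in> cube k" using zs(1) C_cube[OF P(1)] by blast
  then obtain z \<phi> where \<phi>: "strict_mono \<phi>" "(zs \<circ> \<phi>) \<longlonglongrightarrow> z"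
    using seq_compactE[OF compact_imp_seq_compact[OF compact_cube]] by metis
  have "P \<longlonglongrightarrow> p"
    unfolding tendsto_baire_iff eventually_sequentially using P(2) by (meson Suc_le_lessD)
  then have "(P \<circ> \<phi>) \<longlonglongrightarrow> p" by (rule LIMSEQ_subseq_LIMSEQ[OF _ \<phi>(1)])
  then have "z \<in> C p" using C_closed[of "P \<circ> \<phi>" p "zs \<circ> \<phi>" z] P(1) p zs(1) \<phi>(2) by simp
  then have "eventually (\<lambda>j. e \<le> dist ((zs \<circ> \<phi>) j) z) sequentially" using zs(2) by simp
  moreover have "eventually (\<lambda>j. dist ((zs \<circ> \<phi>) j) z < e) sequentially"
    using tendstoD[OF \<phi>(2) e] .
  ultimately have "eventually (\<lambda>_. False) sequentially" by eventually_elim simp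
  then show False by simp
qed

text \<open>Each \<open>P j\<close> is changed so late that its solutions move by less than
  \<open>1 / (j + 1)\<close>. Every accumulation point of the new solutions is then one of the old
  solutions and lies in \<open>Z\<close>.\<close>

lemma refine_approximation:
  assumes P: "\<And>j. P j \<in> V" "P \<longlonglongrightarrow> I0" and Z: "set_limit (\<lambda>j. C (P j)) Z"
    and near: "\<And>j N. \<exists>p'\<in>V. \<Phi> p' \<and> (\<forall>n<N. p' n = P j n)"
  obtains P' where "\<And>j. P' j \<in> V" "\<And>j. \<Phi> (P' j)" "P' \<longlonglongrightarrow> I0"
    "\<And>\<phi> zs z. strict_mono \<phi> \<Longrightarrow> (\<And>j. zs j \<in> C (P' (\<phi> j))) \<Longrightarrow> zs \<longlonglongrightarrow> z \<Longrightarrow> z \<in> Z"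
proof -
  have "\<exists>p'\<in>V. \<Phi> p' \<and> (\<forall>n<j. p' n = P j n) \<and>
      (\<forall>z\<in>C p'. \<exists>z'\<in>C (P j). dist z z' < inverse (real (Suc j)))" for j
    by (rule C_close[OF P(1) _ near]) simp
  then obtain P' where P': "\<And>j. P' j \<in> V" "\<And>j. \<Phi> (P' j)" "\<And>j n. n < j \<Longrightarrow> P' j n = P j n"
    "\<And>j z. z \<in> C (P' j) \<Longrightarrow> \<exists>z'\<in>C (P j). dist z z' < inverse (real (Suc j))" by metis
  have "eventually (\<lambda>j. P' j n = I0 n) sequentially" for n
  proof -
    have "eventually (\<lambda>j. P j n = I0 n) sequentially" using P(2) by (simp add: tendsto_baire_iff)
    then show ?thesis using eventually_gt_at_top[of n] by eventually_elim (simp add: P'(3))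
  qed
  then have "P' \<longlonglongrightarrow> I0" by (simp add: tendsto_baire_iff)
  moreover have "z \<in> Z" if \<phi>: "strict_mono \<phi>" and zs: "\<And>j. zs j \<in> C (P' (\<phi> j))" "zs \<longlonglongrightarrow> z" for \<phi> zs z
  proof -
    obtain ys where ys: "\<And>j. ys j \<in> C (P (\<phi> j))" "\<And>j. dist (zs j) (ys j) < inverse (real (Suc (\<phi> j)))"
      using P'(4)[OF zs(1)] by metis
    have "(\<lambda>j. inverse (real (Suc (\<phi> j)))) \<longlonglongrightarrow> 0"
      using LIMSEQ_subseq_LIMSEQ[OF LIMSEQ_inverse_real_of_nat \<phi>] by (simp add: o_def)
    then have lim: "(\<lambda>j. dist (zs j) z + inverse (real (Suc (\<phi> j)))) \<longlonglongrightarrow> 0"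
      using tendsto_add[OF zs(2)[THEN tendsto_dist_iff[THEN iffD1]]] by force
    have "norm (dist (ys j) z) \<le> dist (zs j) z + inverse (real (Suc (\<phi> j)))" for j
      using ys(2)[of j] dist_triangle3[of "ys j" z "zs j"] by simp
    then have "(\<lambda>j. dist (ys j) z) \<longlonglongrightarrow> 0"
      by (intro Lim_null_comparison[OF always_eventually lim] allI)
    then have "ys \<longlonglongrightarrow> z" by (rule tendsto_dist_iff[THEN iffD2])
    then show ?thesis using Z \<phi> ys(1) unfolding set_limit_def by blast
  qed
  ultimately show ?thesis using that P'(1,2) by blast
qed

section \<open>Limits of solution sets\<close>

lemma approachable_C_I0: "approachable Map.empty (C I0)"
  unfolding approachable_def
proof (intro exI[of _ "\<lambda>_. I0"] conjI allI)
  show "set_limit (\<lambda>_. C I0) (C I0)"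
    unfolding set_limit_def using C_closed[of "\<lambda>_. I0" I0] I0_V by (auto intro!: exI[of _ "\<lambda>_. _"])
qed (rule instance_name_const, rule tendsto_const)

lemma approachable_subset:
  assumes "approachable \<beta> Z"
  shows "Z \<subseteq> C I0"
proof
  fix z assume "z \<in> Z"
  obtain P where P: "\<And>j. instance_name None \<beta> (P j)" "P \<longlonglongrightarrow> I0" "set_limit (\<lambda>j. C (P j)) Z"
    using assms unfolding approachable_def by blast
  then obtain zs where "\<And>j. zs j \<in> C (P j)" "zs \<longlonglongrightarrow> z"
    using \<open>z \<in> Z\<close> unfolding set_limit_def by metis
  then show "z \<in> C I0" using C_closed[of P I0 zs z] instance_V[OF P(1)] I0_V P(2) by blast
qed

text \<open>The lower limit supplies approximations of both endpoints; their convex combinations are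
  solutions, whose limit belongs to the upper limit.\<close>

lemma approachable_convex:
  assumes "approachable \<beta> Z"
  shows "convex Z"
  unfolding convex_alt
proof (intro ballI allI impI)
  fix x y and t :: real assume *: "x \<in> Z" "y \<in> Z" "0 \<le> t \<and> t \<le> 1"
  obtain P where P: "\<And>j. instance_name None \<beta> (P j)" "P \<longlonglongrightarrow> I0" "set_limit (\<lambda>j. C (P j)) Z"
    using assms unfolding approachable_def by blast
  obtain xs ys where xs: "\<And>j. xs j \<in> C (P j)" "xs \<longlonglongrightarrow> x" and ys: "\<And>j. ys j \<in> C (P j)" "ys \<longlonglongrightarrow> y"
    using * P(3) unfolding set_limit_def by meson
  have "(1 - t) *\<^sub>R xs j + t *\<^sub>R ys j \<in> C (P j)" for j
    using convexD_alt[OF C_convex[OF instance_V[OF P(1)]] xs(1) ys(1), of t] * by simp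
  moreover have "(\<lambda>j. (1 - t) *\<^sub>R xs j + t *\<^sub>R ys j) \<longlonglongrightarrow> (1 - t) *\<^sub>R x + t *\<^sub>R y"
    using xs(2) ys(2) by (auto simp: tendsto_fun_iff intro!: tendsto_intros)
  ultimately show "(1 - t) *\<^sub>R x + t *\<^sub>R y \<in> Z"
    using P(3) strict_mono_id unfolding set_limit_def id_def
    by (metis (mono_tags, lifting))
qed

text \<open>The point is revealed late in every approximating instance. A subsequence makes the new
  solution sets converge, and \<open>refine_approximation\<close> keeps the limit inside
  \<open>Z\<close>.\<close>

lemma approachable_step:
  assumes Z: "approachable \<beta> Z" and i: "\<beta> i = None" and b: "b \<in> {0..1}"
  shows "\<exists>Z'\<subseteq>Z. approachable (\<beta>(i \<mapsto> b)) Z'"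
proof -
  obtain P where P: "\<And>j. instance_name None \<beta> (P j)" "P \<longlonglongrightarrow> I0" "set_limit (\<lambda>j. C (P j)) Z"
    using assms unfolding approachable_def by blast
  have near: "\<exists>p'\<in>V. instance_name None (\<beta>(i \<mapsto> b)) p' \<and> (\<forall>n<N. p' n = P j n)" for j N
    using instance_name_reveal_point[OF P(1) i b] instance_V by metis
  obtain P' where P': "\<And>j. P' j \<in> V" "\<And>j. instance_name None (\<beta>(i \<mapsto> b)) (P' j)" "P' \<longlonglongrightarrow> I0"
    "\<And>\<phi> zs z. strict_mono \<phi> \<Longrightarrow> (\<And>j. zs j \<in> C (P' (\<phi> j))) \<Longrightarrow> zs \<longlonglongrightarrow> z \<Longrightarrow> z \<in> Z"
    using refine_approximation[OF instance_V[OF P(1)] P(2,3) near] by blast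
  obtain \<phi> Z' where \<phi>: "strict_mono \<phi>" "set_limit (\<lambda>j. C (P' (\<phi> j))) Z'"
    using set_limit_subsequence[of "\<lambda>j. C (P' j)"] C_nonempty[OF P'(1)] by blast
  have "Z' \<subseteq> Z"
  proof
    fix z assume "z \<in> Z'"
    then obtain zs where "\<And>j. zs j \<in> C (P' (\<phi> j))" "zs \<longlonglongrightarrow> z"
      using \<phi>(2) unfolding set_limit_def by metis
    then show "z \<in> Z" by (rule P'(4)[OF \<phi>(1)])
  qed
  moreover have "approachable (\<beta>(i \<mapsto> b)) Z'"
    unfolding approachable_def
    using P'(2) LIMSEQ_subseq_LIMSEQ[OF P'(3) \<phi>(1)] \<phi>(2)
    by (intro exI[of _ "\<lambda>j. P' (\<phi> j)"]) (simp add: o_def)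
  ultimately show ?thesis by blast
qed

text \<open>Otherwise a late restriction of the first input to the branch would leave no solutions.\<close>

lemma approachable_meets_branch:
  assumes Z: "approachable \<beta> Z" and i: "i \<le> k"
  shows "Z \<inter> branch i \<noteq> {}"
proof -
  \<comment> \<open>A branch that begins with exactly \<open>i\<close> ones;
    \<open>i \<le> k\<close> ensures that all of them are counted.\<close>
  define x :: baire where "x j = (if j < i then 1 else 0)" for j
  have x: "x \<in> cantor" by (simp add: x_def cantor_def)
  have "ones k x = (\<Sum>j<i. 1)"
    unfolding ones_def using i by (intro sum.mono_neutral_cong_right) (auto simp: x_def)
  then have ones: "ones k x = i" by simp
  obtain P where P: "\<And>j. instance_name None \<beta> (P j)" "P \<longlonglongrightarrow> I0" "set_limit (\<lambda>j. C (P j)) Z"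
    using Z unfolding approachable_def by blast
  have near: "\<exists>p'\<in>V. instance_name (Some x) \<beta> p' \<and> (\<forall>n<N. p' n = P j n)" for j N
    using instance_name_reveal_branch[OF P(1) x] instance_V by metis
  obtain P' where P': "\<And>j. P' j \<in> V" "\<And>j. instance_name (Some x) \<beta> (P' j)" "P' \<longlonglongrightarrow> I0"
    "\<And>\<phi> zs z. strict_mono \<phi> \<Longrightarrow> (\<And>j. zs j \<in> C (P' (\<phi> j))) \<Longrightarrow> zs \<longlonglongrightarrow> z \<Longrightarrow> z \<in> Z"
    using refine_approximation[OF instance_V[OF P(1)] P(2,3) near] by blast
  have "\<forall>j. \<exists>z. z \<in> C (P' j)" using C_nonempty[OF P'(1)] by blast
  then obtain ys where ys: "\<And>j. ys j \<in> C (P' j)" by metis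
  have "\<forall>j. ys j \<in> cube k" using ys C_cube[OF P'(1)] by blast
  then obtain z \<phi> where \<phi>: "strict_mono \<phi>" "(ys \<circ> \<phi>) \<longlonglongrightarrow> z"
    using seq_compactE[OF compact_imp_seq_compact[OF compact_cube]] by metis
  let ?zs = "\<lambda>j. ys (\<phi> j)" and ?P = "\<lambda>j. P' (\<phi> j)"
  have zs: "?zs \<longlonglongrightarrow> z" using \<phi>(2) by (simp add: o_def)
  have "z \<in> Z" by (rule P'(4)[OF \<phi>(1) _ zs]) (rule ys)
  then have z: "z \<in> C I0" using approachable_subset[OF Z] by blast
  then obtain r where r: "strict_name k r z" using strict_name_exists C_cube[OF I0_V] by blast
  obtain R where R: "\<And>j. strict_name k (R j) (?zs j)" "R \<longlonglongrightarrow> r"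
    using strict_name_approx[OF r _ zs] ys C_cube[OF P'(1)] by blast
  have P'I0: "?P \<longlonglongrightarrow> I0" using LIMSEQ_subseq_LIMSEQ[OF P'(3) \<phi>(1)] by (simp add: o_def)
  \<comment> \<open>On the restricted instances the answer is forced to be \<open>x\<close>;
    continuity carries this over to \<open>I0\<close>, where A is unrestricted.\<close>
  have "(\<lambda>j. Q (?P j) (R j)) \<longlonglongrightarrow> Q I0 r"
    using QS_continuous[of ?P I0 ?zs R z r] P'(1) I0_V P'I0 ys R z r strict_name_imp_cube_name by blast
  moreover have "Q (?P j) (R j) = x" for j
    using Q_correct[OF P'(2) ys strict_name_imp_cube_name[OF R(1)]] .
  ultimately have "(\<lambda>_. x) \<longlonglongrightarrow> Q I0 r" by (simp only:)
  then have "Q I0 r i = x i" for i by (simp add: tendsto_baire_iff)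
  then have "Q I0 r = x" by (rule ext)
  then have "z \<in> branch i" using z r ones unfolding branch_def by blast
  then show ?thesis using \<open>z \<in> Z\<close> by blast
qed

text \<open>A strict name of \<open>z\<close> is a limit of names of the points \<open>zs j\<close>,
  and \<open>ones k\<close> depends on only finitely many digits of the answer.\<close>

lemma branch_open:
  assumes z: "z \<in> branch i" and zs: "\<And>j. zs j \<in> C I0" "zs \<longlonglongrightarrow> z"
  shows "\<exists>j. zs j \<in> branch i"
proof -
  obtain r where r: "z \<in> C I0" "strict_name k r z" "ones k (Q I0 r) = i"
    using z unfolding branch_def by blast
  obtain R where R: "\<And>j. strict_name k (R j) (zs j)" "R \<longlonglongrightarrow> r"
    using strict_name_approx[OF r(2) _ zs(2)] zs(1) C_cube[OF I0_V] by blast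
  have "(\<lambda>j. Q I0 (R j)) \<longlonglongrightarrow> Q I0 r"
    using QS_continuous[of "\<lambda>_. I0" I0 zs R z r] I0_V zs(1) R r strict_name_imp_cube_name by blast
  from ones_eventually[OF this, of k] have "eventually (\<lambda>j. ones k (Q I0 (R j)) = i) sequentially"
    using r(3) by simp
  then obtain j where "ones k (Q I0 (R j)) = i" using eventually_happens by force
  then show ?thesis using zs(1) R(1) unfolding branch_def by blast
qed

lemma cube_name_closed:
  assumes "R \<longlonglongrightarrow> r" "eventually (\<lambda>j. cube_name n (R j) x) sequentially"
  shows "cube_name n r x"
proof -
  have "eventually (\<lambda>j. cube_name n (R j) x \<and> R j c = r c) sequentially" for c
    using assms by (auto simp: tendsto_baire_iff intro: eventually_conj)
  then have "\<exists>j. cube_name n (R j) x \<and> R j c = r c" for c using eventually_happens by force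
  then show ?thesis unfolding cube_name_def by metis
qed

text \<open>The instances approaching \<open>I0\<close> force the value \<open>b\<close> on this
  branch, and continuity passes it on to \<open>S I0 r\<close>. As \<open>S I0 r\<close> does not
  mention \<open>b\<close>, limits for different \<open>b\<close> are disjoint on the
  branch.\<close>

lemma branch_value:
  assumes Z: "approachable \<beta> Z" and i: "\<beta> i = Some b" and z: "z \<in> Z"
    and r: "strict_name k r z" "ones k (Q I0 r) = i"
  shows "cube_name 1 (S I0 r) (unit_point b)"
proof -
  obtain P where P: "\<And>j. instance_name None \<beta> (P j)" "P \<longlonglongrightarrow> I0" "set_limit (\<lambda>j. C (P j)) Z"
    using Z unfolding approachable_def by blast
  then obtain zs where zs: "\<And>j. zs j \<in> C (P j)" "zs \<longlonglongrightarrow> z"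
    using z unfolding set_limit_def by metis
  have PV: "P j \<in> V" for j using instance_V[OF P(1)] .
  obtain R where R: "\<And>j. strict_name k (R j) (zs j)" "R \<longlonglongrightarrow> r"
    using strict_name_approx[OF r(1) _ zs(2)] zs(1) C_cube[OF PV] by blast
  have "z \<in> C I0" using approachable_subset[OF Z] z by blast
  then have lim: "(\<lambda>j. Q (P j) (R j)) \<longlonglongrightarrow> Q I0 r" "(\<lambda>j. S (P j) (R j)) \<longlonglongrightarrow> S I0 r"
    using QS_continuous[of P I0 zs R z r] PV I0_V P(2) zs(1) R r(1) strict_name_imp_cube_name by blast+
  have "eventually (\<lambda>j. ones k (Q (P j) (R j)) = i) sequentially"
    using ones_eventually[OF lim(1), of k] r(2) by simp
  then have "eventually (\<lambda>j. cube_name 1 (S (P j) (R j)) (unit_point b)) sequentially"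
  proof eventually_elim
    case (elim j)
    then show ?case
      using S_correct[OF P(1) zs(1) strict_name_imp_cube_name[OF R(1)]] i by simp
  qed
  then show ?thesis by (rule cube_name_closed[OF lim(2)])
qed

text \<open>Step \<open>i\<close> restricts B_i to a point for which the limit loses a dimension. At
  \<open>i = Suc k\<close> the bound on \<open>card B\<close> is impossible.\<close>

lemma dimension_drop:
  "i \<le> Suc k \<Longrightarrow> \<exists>\<beta> Z w B. approachable \<beta> Z \<and> (\<forall>j\<ge>i. \<beta> j = None) \<and> finite B \<and> card B + i \<le> k \<and>
     (\<forall>z\<in>Z. z - w \<in> span B)"
proof (induction i)
  case 0
  define w :: "nat \<Rightarrow> real" where "w = (\<lambda>i. if i < k then 0 else undefined)"
  obtain B where B: "finite B" "card B \<le> k" "\<forall>x\<in>cube k. x - w \<in> span B"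
    by (rule cube_subset_span[of k, folded w_def])
  have "z - w \<in> span B" if "z \<in> C I0" for z using B(3) C_cube[OF I0_V] that by blast
  with approachable_C_I0 B(1,2) have "approachable Map.empty (C I0) \<and> (\<forall>j\<ge>0. Map.empty j = None) \<and>
      finite B \<and> card B + 0 \<le> k \<and> (\<forall>z\<in>C I0. z - w \<in> span B)"
    by (intro conjI allI ballI impI) (simp_all only: add_0_right)
  then show ?case
    by - (rule exI[of _ Map.empty], rule exI[of _ "C I0"], rule exI[of _ w], rule exI[of _ B])
next
  case (Suc i)
  have "i \<le> Suc k" using Suc.prems by simp
  from Suc.IH[OF this] obtain \<beta> Z w B where Z: "approachable \<beta> Z" "\<forall>j\<ge>i. \<beta> j = None"
    and B: "finite B" "card B + i \<le> k" "\<forall>z\<in>Z. z - w \<in> span B"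
    by (elim exE conjE) (rule that)
  have "\<forall>b. \<exists>Z'. b \<in> {0..1} \<longrightarrow> Z' \<subseteq> Z \<and> approachable (\<beta>(i \<mapsto> b)) Z'"
    using approachable_step[OF Z(1), of i] Z(2) by simp
  then obtain Zb where Zb: "\<And>b. b \<in> {0..1} \<Longrightarrow> Zb b \<subseteq> Z"
    "\<And>b. b \<in> {0..1} \<Longrightarrow> approachable (\<beta>(i \<mapsto> b)) (Zb b)" by metis
  have sub: "Zb b \<subseteq> C I0" if "b \<in> {0..1}" for b using approachable_subset[OF Zb(2)[OF that]] .
  obtain b w' B' where *: "b \<in> {0..1}" "finite B'" "card B' < card B"
    "\<And>z. z \<in> Zb b \<Longrightarrow> z - w' \<in> span B'"
  proof (rule lower_dimensional_convex[of Zb k B w "branch i"])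
    show "Zb b \<subseteq> cube k" if "b \<in> {0..1}" for b using sub[OF that] C_cube[OF I0_V] by blast
    show "convex (Zb b)" if "b \<in> {0..1}" for b using approachable_convex[OF Zb(2)[OF that]] .
    show "z - w \<in> span B" if "b \<in> {0..1}" "z \<in> Zb b" for b z using Zb(1) B(3) that by blast
    show "Zb b \<inter> branch i \<noteq> {}" if "b \<in> {0..1}" for b
      using approachable_meets_branch[OF Zb(2)[OF that]] Suc.prems by simp
    show "\<exists>j. zs j \<in> branch i"
      if "b \<in> {0..1}" "z \<in> Zb b \<inter> branch i" "range zs \<subseteq> Zb b" "zs \<longlonglongrightarrow> z" for b z zs
      using branch_open[of z i zs] that sub[OF that(1)] by blast
    \<comment> \<open>One strict name of a common point would make \<open>S I0 r\<close> a name of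
      two different points.\<close>
    show "Zb b \<inter> Zb b' \<inter> branch i = {}" if b: "b \<in> {0..1}" "b' \<in> {0..1}" "b \<noteq> b'" for b b'
    proof (rule ccontr)
      assume "Zb b \<inter> Zb b' \<inter> branch i \<noteq> {}"
      then obtain z r where z: "z \<in> Zb b" "z \<in> Zb b'" "strict_name k r z" "ones k (Q I0 r) = i"
        unfolding branch_def by blast
      have "cube_name 1 (S I0 r) (unit_point b)"
        by (rule branch_value[OF Zb(2)[OF b(1)] _ z(1,3,4)]) simp
      moreover have "cube_name 1 (S I0 r) (unit_point b')"
        by (rule branch_value[OF Zb(2)[OF b(2)] _ z(2,3,4)]) simp
      ultimately show False using b(3) by (metis cube_name_unique unit_point_inject)
    qed
  qed (use B(1) in auto)
  have "approachable (\<beta>(i \<mapsto> b)) (Zb b) \<and> (\<forall>j\<ge>Suc i. (\<beta>(i \<mapsto> b)) j = None) \<and>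
      finite B' \<and> card B' + Suc i \<le> k \<and> (\<forall>z\<in>Zb b. z - w' \<in> span B')"
    using Zb(2)[OF *(1)] Z(2) B(2) *(2-4) by (intro conjI ballI) simp_all
  then show ?case
    by - (rule exI[of _ "\<beta>(i \<mapsto> b)"], rule exI[of _ "Zb b"], rule exI[of _ w'], rule exI[of _ B'])
qed

theorem contradiction: False
proof -
  from dimension_drop[OF order_refl] have "\<exists>n. n + Suc k \<le> k" by (elim exE conjE) (rule exI)
  then show False by simp
qed

end

section \<open>Correctness of the composition\<close>

definition pointwise_reduction ::
    "('a, 'b) problem \<Rightarrow> ('c, 'd) problem \<Rightarrow> (baire \<Rightarrow> baire option) \<Rightarrow> (baire \<Rightarrow> baire option) \<Rightarrow> bool" where
  "pointwise_reduction f g H K \<longleftrightarrow> (\<forall>p x. src f p = Some x \<and> x \<in> mdom f \<longrightarrow>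
     (\<exists>h A. H p = Some h \<and> src g h = Some A \<and> A \<in> mdom g \<and>
        (\<forall>q y. tgt g q = Some y \<and> y \<in> mv g A \<longrightarrow>
          (\<exists>w v. K (baire_pair p q) = Some w \<and> tgt f w = Some v \<and> v \<in> mv f x))))"

text \<open>Any solution of a single instance is the value of some realizer, so the outer functional
  must succeed on every solution. This removes realizers from the argument.\<close>

lemma weihrauch_le_pointwise:
  assumes "f \<le>\<^sub>W g" and g: "valid_problem g"
  obtains H K where "computable H" "computable K" "pointwise_reduction f g H K"
proof -
  obtain H K where HK: "computable H" "computable K"
    "\<And>G. realizes G g \<Longrightarrow>
       realizes (\<lambda>p. Option.bind (H p) (\<lambda>h. Option.bind (G h) (\<lambda>q. K (baire_pair p q)))) f"
    using assms(1) unfolding weihrauch_le_def by blast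
  define good where "good h q \<longleftrightarrow> (\<exists>A y. src g h = Some A \<and> tgt g q = Some y \<and> y \<in> mv g A)" for h q
  define G0 where "G0 h = (if \<exists>q. good h q then Some (SOME q. good h q) else None)" for h
  have good: "\<exists>q. good h q" if "src g h = Some A" "A \<in> mdom g" for h A
    using g that unfolding valid_problem_def mdom_def points_def good_def by blast
  \<comment> \<open>A fixed realizer is overridden at one name by an arbitrary solution.\<close>
  have G0: "realizes (G0(h := Some q)) g" if q: "good h q" for h q
    unfolding realizes_def
  proof (intro allI impI, elim conjE)
    fix p x assume p: "src g p = Some x" "x \<in> mdom g"
    have "\<exists>q'. (G0(h := Some q)) p = Some q' \<and> good p q'"
      using q good[OF p] someI_ex[OF good[OF p]] by (auto simp: G0_def)
    then show "\<exists>q' y. (G0(h := Some q)) p = Some q' \<and> tgt g q' = Some y \<and> y \<in> mv g x"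
      using p by (auto simp: good_def)
  qed
  show ?thesis
  proof (rule that[OF HK(1,2)], unfold pointwise_reduction_def, intro allI impI, elim conjE)
    fix p x assume p: "src f p = Some x" "x \<in> mdom f"
    have *: "\<exists>h q' w v. H p = Some h \<and> (G0(h' := Some q)) h = Some q' \<and> K (baire_pair p q') = Some w
      \<and> tgt f w = Some v \<and> v \<in> mv f x" if good': "good h' q" for h' q
    proof -
      obtain w v where "Option.bind (H p) (\<lambda>h. Option.bind ((G0(h' := Some q)) h)
          (\<lambda>q. K (baire_pair p q))) = Some w" "tgt f w = Some v" "v \<in> mv f x"
        using HK(3)[OF G0[OF good']] p unfolding realizes_def by blast
      then show ?thesis unfolding bind_eq_Some_conv by blast
    qed
    \<comment> \<open>\<open>G0\<close> is undefined on names without solutions, so success of the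
      composite on \<open>p\<close> shows that \<open>H p\<close> names a point of the
      domain.\<close>
    have "realizes G0 g"
      unfolding realizes_def
    proof (intro allI impI, elim conjE)
      fix p x assume p: "src g p = Some x" "x \<in> mdom g"
      have "\<exists>q'. G0 p = Some q' \<and> good p q'"
        using good[OF p] someI_ex[OF good[OF p]] by (auto simp: G0_def)
      then show "\<exists>q' y. G0 p = Some q' \<and> tgt g q' = Some y \<and> y \<in> mv g x"
        using p by (auto simp: good_def)
    qed
    from HK(3)[OF this] p obtain u where "Option.bind (H p) (\<lambda>h. Option.bind (G0 h)
        (\<lambda>q. K (baire_pair p q))) = Some u"
      unfolding realizes_def by blast
    then obtain h q where h: "H p = Some h" "G0 h = Some q" unfolding bind_eq_Some_conv by blast
    then obtain q where "good h q" by (auto simp: G0_def split: if_splits)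
    then obtain A where A: "src g h = Some A" "A \<in> mdom g" by (auto simp: good_def mdom_def)
    have "\<exists>w v. K (baire_pair p q) = Some w \<and> tgt f w = Some v \<and> v \<in> mv f x"
      if "tgt g q = Some y" "y \<in> mv g A" for q y
    proof -
      have "good h q" using A that by (auto simp: good_def)
      from *[OF this] h(1) show ?thesis by auto
    qed
    then show "\<exists>h A. H p = Some h \<and> src g h = Some A \<and> A \<in> mdom g \<and>
        (\<forall>q y. tgt g q = Some y \<and> y \<in> mv g A \<longrightarrow>
          (\<exists>w v. K (baire_pair p q) = Some w \<and> tgt f w = Some v \<and> v \<in> mv f x))"
      using h(1) A by blast
  qed
qed

text \<open>A point \<open>z\<close> outside \<open>B\<close> is refuted by \<open>n\<close> after
  finitely many digits of a strict name. For large \<open>j\<close> the same refutation would apply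
  to \<open>zs j\<close>, which belongs to \<open>A j\<close>.\<close>

lemma closed_name_limit:
  assumes N: "\<And>j. closed_name (cube_repr k) (N j) (A j)" and n: "closed_name (cube_repr k) n B"
    and lim: "N \<longlonglongrightarrow> n" and zs: "\<And>j. zs j \<in> A j" "zs \<longlonglongrightarrow> z"
  shows "z \<in> B"
proof (rule ccontr)
  assume z: "z \<notin> B"
  have cube: "zs j \<in> cube k" for j
    using N zs(1) by (auto simp: closed_name_def points_cube_repr)
  then have "z \<in> cube k"
    using closed_sequentially[OF compact_imp_closed[OF compact_cube]] zs(2) by blast
  then obtain r where r: "strict_name k r z" using strict_name_exists by blast
  then obtain R where R: "\<And>j. strict_name k (R j) (zs j)" "R \<longlonglongrightarrow> r"
    using strict_name_approx[OF r _ zs(2)] cube by blast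
  have "cube_repr k r = Some z"
    using r by (simp add: cube_repr_eq_Some_iff strict_name_imp_cube_name)
  then obtain \<rho> where \<rho>: "assoc_fun n r = Some \<rho>" "sierpinski \<rho> = Some (z \<notin> B)"
    using n unfolding closed_name_def function_name_def by blast
  obtain i where i: "\<rho> i \<noteq> 0" using \<rho>(2) z by (auto simp: sierpinski_def)
  define L where "L = (LEAST m. n (assoc_query r i m) \<noteq> 0)"
  have ex: "\<exists>m. n (assoc_query r i m) \<noteq> 0" and \<rho>i: "\<rho> i = n (assoc_query r i L) - 1"
    using \<rho>(1) by (auto simp: assoc_fun_def L_def split: if_splits)
  have L: "n (assoc_query r i L) \<noteq> 0" "\<And>m. m < L \<Longrightarrow> n (assoc_query r i m) = 0"
    unfolding L_def using LeastI_ex[OF ex] not_less_Least by blast+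
  have "eventually (\<lambda>j. \<forall>m\<in>{..<L}. R j m = r m) sequentially"
    using R(2) by (intro eventually_ball_finite) (auto simp: tendsto_baire_iff)
  \<comment> \<open>The queries shorter than \<open>L\<close> must agree as well, because the
    shortest answered prefix counts.\<close>
  moreover have "eventually (\<lambda>j. \<forall>m\<in>{..L}. N j (assoc_query r i m) = n (assoc_query r i m)) sequentially"
    using lim by (intro eventually_ball_finite) (auto simp: tendsto_baire_iff)
  ultimately have "eventually (\<lambda>j. False) sequentially"
  proof eventually_elim
    case (elim j)
    have query: "assoc_query (R j) i m = assoc_query r i m" if "m \<le> L" for m
    proof -
      have "map (R j) [0..<m] = map r [0..<m]" using elim(1) that by auto
      then show ?thesis by (simp only: assoc_query_def)
    qed
    have least: "(LEAST m. N j (assoc_query (R j) i m) \<noteq> 0) = L"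
    proof (rule Least_equality)
      show "N j (assoc_query (R j) i L) \<noteq> 0" using elim(2) query L(1) by simp
      fix m assume m: "N j (assoc_query (R j) i m) \<noteq> 0"
      show "L \<le> m"
      proof (rule ccontr)
        assume "\<not> L \<le> m"
        then show False using m elim(2) query[of m] L(2)[of m] by simp
      qed
    qed
    have "cube_repr k (R j) = Some (zs j)"
      using R(1) by (simp add: cube_repr_eq_Some_iff strict_name_imp_cube_name)
    then obtain \<sigma> where \<sigma>: "assoc_fun (N j) (R j) = Some \<sigma>" "sierpinski \<sigma> = Some (zs j \<notin> A j)"
      using N unfolding closed_name_def function_name_def by blast
    have "\<sigma> i = N j (assoc_query (R j) i (LEAST m. N j (assoc_query (R j) i m) \<noteq> 0)) - 1"
      using \<sigma>(1) by (auto simp: assoc_fun_def split: if_splits)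
    also have "\<dots> = \<rho> i" unfolding least \<rho>i using query elim(2) by simp
    finally show False using \<sigma>(2) i zs(1)[of j] by (auto simp: sierpinski_def)
  qed
  then show False by simp
qed

text \<open>This makes an interval from which nothing has been removed an admissible input of
  \<open>XC 1\<close>.\<close>

lemma cube_convex_cube: "cube_convex n (cube n)"
  unfolding cube_convex_def
proof (intro ballI)
  fix x y and t :: real assume xy: "x \<in> cube n" "y \<in> cube n" and t: "t \<in> {0..1}"
  have "(1 - t) * x i + t * y i \<in> {0..1}" if "i < n" for i
  proof -
    have "x i \<in> {0..1}" "y i \<in> {0..1}"
      using xy that PiE_mem[of _ "{..<n}" "\<lambda>_. {0..1::real}" i] unfolding cube_def by blast+
    moreover have "convex {0..1::real}" by simp
    ultimately show ?thesis using convexD_alt[of "{0..1::real}" "x i" "y i" t] t by simp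
  qed
  then show "(\<lambda>i\<in>{..<n}. (1 - t) * x i + t * y i) \<in> cube n"
    unfolding cube_def by (intro restrict_PiE_iff[THEN iffD2]) blast
qed

lemma cube_convex_singleton: "x \<in> cube n \<Longrightarrow> cube_convex n {x}"
  using convex_comb_cube[of x n x] by (simp add: cube_convex_def flip: scaleR_left_distrib)

section \<open>The instances and solutions of the composition\<close>

definition branch_set :: "baire option \<Rightarrow> baire set" where
  "branch_set \<alpha> = (case \<alpha> of None \<Rightarrow> cantor | Some x \<Rightarrow> {x})"

definition value_set :: "real option \<Rightarrow> (nat \<Rightarrow> real) set" where
  "value_set \<beta> = (case \<beta> of None \<Rightarrow> cube 1 | Some b \<Rightarrow> {unit_point b})"

lemma points_cantor_repr: "points cantor_repr = cantor"
  by (auto simp: points_def cantor_repr_def)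

lemma AoUC_eq:
  assumes "instance_name \<alpha> \<beta> p"
  shows "src AoUC (slice p 0) = Some (branch_set \<alpha>)" "mv AoUC (branch_set \<alpha>) = branch_set \<alpha>"
    "branch_set \<alpha> \<subseteq> cantor" "branch_set \<alpha> \<noteq> {}"
proof -
  have name: "closed_name cantor_repr (slice p 0) (branch_set \<alpha>)"
    using assms closed_name_all[of cantor_repr]
    by (cases \<alpha>) (auto simp: instance_name_def branch_set_def points_cantor_repr)
  then show "src AoUC (slice p 0) = Some (branch_set \<alpha>)"
    by (simp add: AoUC_def restrict_problem_def closed_choice_def closed_sets_eq_Some_iff)
  then have "branch_set \<alpha> \<in> points (closed_sets cantor_repr)"
    using name by (auto simp: points_def closed_sets_eq_Some_iff)
  then show "mv AoUC (branch_set \<alpha>) = branch_set \<alpha>"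
    using assms by (cases \<alpha>)
      (auto simp: AoUC_def restrict_problem_def closed_choice_def instance_name_def branch_set_def)
  show "branch_set \<alpha> \<subseteq> cantor"
    using assms by (cases \<alpha>) (auto simp: instance_name_def branch_set_def)
  have "(\<lambda>_. 0) \<in> cantor" by (simp add: cantor_def)
  then show "branch_set \<alpha> \<noteq> {}" by (cases \<alpha>) (auto simp: branch_set_def)
qed

lemma XC_eq:
  assumes "instance_name \<alpha> \<beta> p"
  shows "src (XC 1) (slice p (Suc i)) = Some (value_set (\<beta> i))"
    "mv (XC 1) (value_set (\<beta> i)) = value_set (\<beta> i)"
    "value_set (\<beta> i) \<subseteq> cube 1" "value_set (\<beta> i) \<noteq> {}"
proof -
  have name: "closed_name (cube_repr 1) (slice p (Suc i)) (value_set (\<beta> i))"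
    using assms closed_name_all[of "cube_repr 1"]
    by (cases "\<beta> i") (auto simp: instance_name_def value_set_def points_cube_repr)
  then show "src (XC 1) (slice p (Suc i)) = Some (value_set (\<beta> i))"
    by (simp add: XC_def restrict_problem_def closed_choice_def closed_sets_eq_Some_iff)
  have points: "value_set (\<beta> i) \<in> points (closed_sets (cube_repr 1))"
    using name by (auto simp: points_def closed_sets_eq_Some_iff)
  have b: "b \<in> {0..1}" if "\<beta> i = Some b" for b
    using assms that unfolding instance_name_def by blast
  have "cube_convex 1 (value_set (\<beta> i))"
    using cube_convex_cube[of 1] cube_convex_singleton[OF unit_point_cube[OF b]]
    by (cases "\<beta> i") (simp_all add: value_set_def)
  then show "mv (XC 1) (value_set (\<beta> i)) = value_set (\<beta> i)"
    using points by (simp add: XC_def restrict_problem_def closed_choice_def)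
  show "value_set (\<beta> i) \<subseteq> cube 1"
    using unit_point_cube[OF b] by (cases "\<beta> i") (simp_all add: value_set_def)
  show "value_set (\<beta> i) \<noteq> {}"
    using unit_point_cube[of 0] by (cases "\<beta> i") (auto simp: value_set_def)
qed

text \<open>The nested pairs keep the instance, the branch and the name of the value, so branch and
  value can be read off a solution.\<close>

lemma composition_mv:
  assumes p: "instance_name \<alpha> \<beta> p"
  shows "mv (composition k) p = {baire_pair (baire_pair p q) s | q s y.
    q \<in> branch_set \<alpha> \<and> y \<in> value_set (\<beta> (ones k q)) \<and> cube_name 1 s y}"
proof -
  have g1: "mv (lift_problem AoUC (\<lambda>p. slice p 0)) p = baire_pair p ` branch_set \<alpha>"
  proof -
    have "tgt AoUC s = Some y \<longleftrightarrow> s \<in> cantor \<and> y = s" for s y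
      by (auto simp: AoUC_def restrict_problem_def closed_choice_def cantor_repr_def)
    then have "mv (lift_problem AoUC (\<lambda>p. slice p 0)) p =
        {baire_pair p s | s. s \<in> branch_set \<alpha> \<and> s \<in> cantor}"
      using AoUC_eq(1,2)[OF p] by (auto simp: lift_problem_def)
    then show ?thesis using AoUC_eq(3)[OF p] by blast
  qed
  have sel: "selected_slice k (baire_pair p q) = slice p (Suc (ones k q))" for q
    by (simp add: selected_slice_def)
  have tgt: "tgt (XC 1) = cube_repr 1"
    by (simp add: XC_def restrict_problem_def closed_choice_def)
  have f1: "mv (lift_problem (XC 1) (selected_slice k)) (baire_pair p q) =
      {baire_pair (baire_pair p q) s | s y. y \<in> value_set (\<beta> (ones k q)) \<and> cube_name 1 s y}" for q
    using XC_eq[OF p, of "ones k q"] 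
    by (auto simp: lift_problem_def sel tgt cube_repr_eq_Some_iff simp del: One_nat_def)
  \<comment> \<open>A composition is defined only where every intermediate result lies in the domain
    of the outer problem.\<close>
  have ne: "mv (lift_problem (XC 1) (selected_slice k)) (baire_pair p q) \<noteq> {}" for q
  proof -
    obtain y where y: "y \<in> value_set (\<beta> (ones k q))" "y \<in> cube 1"
      using XC_eq(3,4)[OF p, of "ones k q"] by blast
    obtain s where "strict_name 1 s y" by (rule strict_name_exists[OF y(2)])
    then have "cube_name 1 s y" by (rule strict_name_imp_cube_name)
    then show ?thesis using y(1) unfolding f1 ex_in_conv[symmetric] mem_Collect_eq
      by (intro exI[of _ "baire_pair (baire_pair p q) s"] exI[of _ s] exI[of _ y] conjI refl)
  qed
  have "p \<in> mdom (lift_problem AoUC (\<lambda>p. slice p 0))"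
    using AoUC_eq(4)[OF p] by (auto simp: mdom_def g1)
  moreover have "mv (lift_problem AoUC (\<lambda>p. slice p 0)) p \<subseteq> mdom (lift_problem (XC 1) (selected_slice k))"
    using ne by (auto simp: mdom_def g1)
  ultimately have "mv (composition k) p = (\<Union>q\<in>branch_set \<alpha>.
      mv (lift_problem (XC 1) (selected_slice k)) (baire_pair p q))"
    by (simp add: composition_def mcomp_def g1)
  also have "\<dots> = {baire_pair (baire_pair p q) s | q s y.
      q \<in> branch_set \<alpha> \<and> y \<in> value_set (\<beta> (ones k q)) \<and> cube_name 1 s y}"
    unfolding f1 by auto
  finally show ?thesis .
qed

lemma composition_mdom:
  assumes p: "instance_name \<alpha> \<beta> p"
  shows "p \<in> mdom (composition k)"
proof -
  obtain q where q: "q \<in> branch_set \<alpha>" using AoUC_eq(4)[OF p] by blast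
  obtain y where y: "y \<in> value_set (\<beta> (ones k q))" "y \<in> cube 1"
    using XC_eq(3,4)[OF p, of "ones k q"] by blast
  obtain s where "strict_name 1 s y" by (rule strict_name_exists[OF y(2)])
  then have "cube_name 1 s y" by (rule strict_name_imp_cube_name)
  then have "baire_pair (baire_pair p q) s \<in> mv (composition k) p"
    unfolding composition_mv[OF p] mem_Collect_eq
    using q y(1) by (intro exI[of _ q] exI[of _ s] exI[of _ y] conjI refl)
  then show ?thesis unfolding mdom_def by blast
qed

lemma composition_src_tgt: "src (composition k) = Some" "tgt (composition k) = Some"
  by (simp_all add: composition_def mcomp_def lift_problem_def)

lemma XC_simps:
  "src (XC k) p = Some A \<longleftrightarrow> closed_name (cube_repr k) p A"
  "tgt (XC k) = cube_repr k"
  "y \<in> mv (XC k) A \<longleftrightarrow> cube_convex k A \<and> A \<in> points (closed_sets (cube_repr k)) \<and> y \<in> A"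
  by (simp_all add: XC_def restrict_problem_def closed_choice_def closed_sets_eq_Some_iff)

theorem theorem32:
  fixes k :: nat and h :: "('a, 'b) problem"
  assumes "is_comp_product (XC 1) AoUC h"
  shows "\<not> h \<le>\<^sub>W XC k"
proof
  assume le: "h \<le>\<^sub>W XC k"
  have h: "valid_problem h" "composition k \<le>\<^sub>W h"
    using assms comp_candidate_composition[of k] by (simp_all add: is_comp_product_def)
  have XC: "valid_problem (XC k)"
    unfolding XC_def by (intro valid_problem_restrict valid_problem_closed_choice)
  obtain H1 K1 where 1: "computable H1" "computable K1" "pointwise_reduction (composition k) h H1 K1"
    by (rule weihrauch_le_pointwise[OF h(2,1)])
  obtain H2 K2 where 2: "computable H2" "computable K2" "pointwise_reduction h (XC k) H2 K2"
    by (rule weihrauch_le_pointwise[OF le XC])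
  \<comment> \<open>The two reductions are chained name by name: \<open>M\<close> and
    \<open>N\<close> are the forward images of an instance, \<open>U\<close> and \<open>W\<close>
    the backward images of a solution name. The totalised functionals have their intended values on
    \<open>V\<close>, by \<open>key\<close>.\<close>
  define V where "V = mdom (composition k)"
  define M where "M p = the (H1 p)" for p
  define N where "N p = the (H2 (M p))" for p
  define C where "C p = the (closed_sets (cube_repr k) (N p))" for p
  define U where "U p r = the (K2 (baire_pair (M p) r))" for p r
  define W where "W p r = the (K1 (baire_pair p (U p r)))" for p r
  have key: "H1 p = Some (M p) \<and> H2 (M p) = Some (N p) \<and> closed_name (cube_repr k) (N p) (C p) \<and>
      cube_convex k (C p) \<and> C p \<noteq> {} \<and> (\<forall>z r. z \<in> C p \<and> cube_name k r z \<longrightarrow>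
        K2 (baire_pair (M p) r) = Some (U p r) \<and> K1 (baire_pair p (U p r)) = Some (W p r) \<and>
        W p r \<in> mv (composition k) p)" if p: "p \<in> V" for p
  proof -
    obtain h1 A1 where h1: "H1 p = Some h1" "src h h1 = Some A1" "A1 \<in> mdom h"
      "\<forall>q y. tgt h q = Some y \<and> y \<in> mv h A1 \<longrightarrow> (\<exists>w v. K1 (baire_pair p q) = Some w \<and>
        tgt (composition k) w = Some v \<and> v \<in> mv (composition k) p)"
      using 1(3) p unfolding V_def pointwise_reduction_def composition_src_tgt(1) by blast
    obtain h2 A where h2: "H2 h1 = Some h2" "src (XC k) h2 = Some A" "A \<in> mdom (XC k)"
      "\<forall>q y. tgt (XC k) q = Some y \<and> y \<in> mv (XC k) A \<longrightarrow>
        (\<exists>w v. K2 (baire_pair h1 q) = Some w \<and> tgt h w = Some v \<and> v \<in> mv h A1)"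
      using 2(3) h1(2,3) unfolding pointwise_reduction_def by blast
    have M: "M p = h1" and N: "N p = h2" and C: "C p = A"
      using h1(1) h2(1,2) by (simp_all add: M_def N_def C_def XC_simps closed_sets_eq_Some_iff[symmetric])
    obtain y where "y \<in> mv (XC k) A" using h2(3) unfolding mdom_def by blast
    then have A: "cube_convex k A" "A \<noteq> {}" "A \<in> points (closed_sets (cube_repr k))"
      unfolding XC_simps by blast+
    have "K2 (baire_pair (M p) r) = Some (U p r) \<and> K1 (baire_pair p (U p r)) = Some (W p r) \<and>
        W p r \<in> mv (composition k) p" if z: "z \<in> C p" "cube_name k r z" for z r
    proof -
      have "tgt (XC k) r = Some z" "z \<in> mv (XC k) A"
        using z A C unfolding XC_simps cube_repr_eq_Some_iff by blast+
      then obtain u v where u: "K2 (baire_pair h1 r) = Some u" "tgt h u = Some v" "v \<in> mv h A1"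
        using h2(4) by blast
      then obtain w where w: "K1 (baire_pair p u) = Some w" "w \<in> mv (composition k) p"
        using h1(4) unfolding composition_src_tgt(2) by blast
      have "U p r = u" using u(1) by (simp add: U_def M)
      moreover from this have "W p r = w" using w(1) by (simp add: W_def)
      ultimately show ?thesis using u(1) w M by simp
    qed
    moreover have "H1 p = Some (M p) \<and> H2 (M p) = Some (N p) \<and> closed_name (cube_repr k) (N p) (C p)
        \<and> cube_convex k (C p) \<and> C p \<noteq> {}"
      using h1(1) h2(1,2) A(1,2) M N C unfolding XC_simps(1) by simp
    ultimately show ?thesis by blast
  qed
  have H1: "H1 p = Some (M p)" and H2: "H2 (M p) = Some (N p)"
    and C: "closed_name (cube_repr k) (N p) (C p)" "cube_convex k (C p)" "C p \<noteq> {}" if "p \<in> V" for p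
    using key[OF that] by simp_all
  have K2: "K2 (baire_pair (M p) r) = Some (U p r)" and K1: "K1 (baire_pair p (U p r)) = Some (W p r)"
    and W: "W p r \<in> mv (composition k) p" if "p \<in> V" "z \<in> C p" "cube_name k r z" for p z r
    using key[OF that(1)] that(2,3) by blast+
  \<comment> \<open>In a pair of a pair, the inner second component sits at the doubled odd
    positions and the outer second component at the odd positions.\<close>
  define Q where "Q p r n = W p r (2 * Suc (2 * n))" for p r n
  define S where "S p r n = W p r (Suc (2 * n))" for p r n
  have QS: "Q p r = q \<and> S p r = s" if "W p r = baire_pair (baire_pair p q) s" for p r q s
    using that by (simp add: Q_def S_def fun_eq_iff del: mult_Suc_right)
  have cube: "C p \<subseteq> cube k" if "p \<in> V" for p
    using C(1)[OF that] by (simp add: closed_name_def points_cube_repr)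
  have convex: "convex (C p)" if "p \<in> V" for p
    using cube_convex_imp_convex[OF C(2)[OF that] cube[OF that]] .
  have M: "(\<lambda>j. M (P j)) \<longlonglongrightarrow> M p" if "\<And>j. P j \<in> V" "p \<in> V" "P \<longlonglongrightarrow> p" for P p
    by (rule computable_tendsto[OF 1(1) that(3)]) (rule H1 that)+
  have closed: "z \<in> C p"
    if P: "\<And>j. P j \<in> V" "p \<in> V" "P \<longlonglongrightarrow> p" and zs: "\<And>j. zs j \<in> C (P j)" "zs \<longlonglongrightarrow> z" for P p zs z
  proof -
    have N: "(\<lambda>j. N (P j)) \<longlonglongrightarrow> N p"
      by (rule computable_tendsto[OF 2(1) M[OF P]]) (rule H2 P)+
    show ?thesis
      by (rule closed_name_limit[where N = "\<lambda>j. N (P j)" and A = "\<lambda>j. C (P j)" and n = "N p", OF _ _ N])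
        (rule C P zs)+
  qed
  have continuous: "(\<lambda>j. Q (P j) (R j)) \<longlonglongrightarrow> Q p r \<and> (\<lambda>j. S (P j) (R j)) \<longlonglongrightarrow> S p r"
    if P: "\<And>j. P j \<in> V" "p \<in> V" "P \<longlonglongrightarrow> p" and zs: "\<And>j. zs j \<in> C (P j)"
      and R: "\<And>j. cube_name k (R j) (zs j)" "z \<in> C p" "cube_name k r z" "R \<longlonglongrightarrow> r"
    for P p zs R z r
  proof -
    have U: "(\<lambda>j. U (P j) (R j)) \<longlonglongrightarrow> U p r"
      by (rule computable_tendsto[OF 2(2) baire_pair_tendsto[OF M[OF P] R(4)]]) (rule K2 P zs R)+
    have "(\<lambda>j. W (P j) (R j)) \<longlonglongrightarrow> W p r"
      by (rule computable_tendsto[OF 1(2) baire_pair_tendsto[OF P(3) U]]) (rule K1 P zs R)+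
    then show ?thesis unfolding tendsto_baire_iff Q_def S_def by blast
  qed
  have instance_V: "p \<in> V" if "instance_name \<alpha> \<beta> p" for \<alpha> \<beta> p
    unfolding V_def using composition_mdom[OF that] .
  have solution: "Q p r \<in> branch_set \<alpha> \<and> (\<exists>y\<in>value_set (\<beta> (ones k (Q p r))). cube_name 1 (S p r) y)"
    if p: "instance_name \<alpha> \<beta> p" and z: "z \<in> C p" "cube_name k r z" for \<alpha> \<beta> p z r
  proof -
    obtain q s y where *: "W p r = baire_pair (baire_pair p q) s" "q \<in> branch_set \<alpha>"
      "y \<in> value_set (\<beta> (ones k q))" "cube_name 1 s y"
      using W[OF instance_V[OF p] z] unfolding composition_mv[OF p] by blast
    then show ?thesis using QS[OF *(1)] by blast
  qed
  have Q: "Q p r = x"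
    if "instance_name (Some x) \<beta> p" "z \<in> C p" "cube_name k r z" for x \<beta> p z r
    using solution[OF that] by (simp add: branch_set_def)
  have S: "cube_name 1 (S p r) (unit_point b)"
    if "instance_name \<alpha> \<beta> p" "z \<in> C p" "cube_name k r z" "\<beta> (ones k (Q p r)) = Some b"
    for \<alpha> \<beta> p z r b
    using solution[OF that(1-3)] that(4) by (simp add: value_set_def)
  have "xc_reduction k C Q S V"
    by (rule xc_reduction.intro)
      (fact instance_V, fact C(3), fact cube, fact convex, fact closed, fact continuous, fact Q, fact S)
  then show False by (rule xc_reduction.contradiction)
qed

end
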